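(* Let $\mathsf{k}$ be an algebraically closed field, let $m\geq 1$ be an integer, and let $\Lambda=\mathsf{k}Q/I$ be an $m$-cluster tilted algebra of type $\tilde{\mathbb{A}}$ with bound quiver $(Q,I)$. If $(Q,I)$ contains at least one $m$-saturated cycle, then the cup product on the Hochschild cohomology $\operatorname{HH}^*(\Lambda)=\bigoplus_{n\geq 0}\operatorname{HH}^n(\Lambda)$ is non-trivial; and if moreover $\operatorname{char}\mathsf{k}=0$, then the (Gerstenhaber) Lie bracket on $\operatorname{HH}^*(\Lambda)$ is also non-trivial.
   Context: $m$-cluster tilted algebras of type $\tilde{\mathbb{A}}$: let $H=\mathsf{k}\Delta$ with $\Delta$ an acyclic quiver whose underlying graph is of Euclidean type $\tilde{\mathbb{A}}$. The $m$-cluster category is the orbit category $\mathcal{C}_m(H)=\mathcal{D}^b(H)/\tau^{-1}[m]$, where $\tau$ is the Auslander–Reiten translation and $[m]$ the $m$-th power of the shift; it is triangulated. A (basic) object $T$ of $\mathcal{C}_m(H)$ is $m$-cluster tilting if, for every object $X$, one has $\operatorname{Ext}^i_{\mathcal{C}_m(H)}(T,X)=0$ for all $1\leq i\leq m$ if and only if $X\in\operatorname{add}T$. An $m$-cluster tilted algebra of type $\tilde{\mathbb{A}}$ is the endomorphism algebra of such a $T$. It is known that such an algebra is gentle, i.e. of the form $\mathsf{k}Q/I$ with $I$ admissible and generated by paths of length two, such that at most two arrows enter and at most two leave each vertex, and for every arrow $\alpha$ there is at most one arrow $\beta$ with $t(\alpha)=s(\beta)$, $\alpha\beta\notin I$,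 at most one $\gamma$ with $t(\gamma)=s(\alpha)$, $\gamma\alpha\notin I$, at most one $\beta$ with $t(\alpha)=s(\beta)$, $\alpha\beta\in I$, and at most one $\gamma$ with $t(\gamma)=s(\alpha)$, $\gamma\alpha\in I$ (paths are composed left to right). An $m$-saturated cycle in $(Q,I)$ is an oriented cycle consisting of $m+2$ arrows such that the composition of any two cyclically consecutive arrows on it lies in $I$. Hochschild cohomology is $\operatorname{HH}^n(\Lambda)=\operatorname{Ext}^n_{\Lambda\text{-}\Lambda}(\Lambda,\Lambda)$ (extensions of bimodules). With $E=\mathsf{k}Q_0$ and tensor products over $E$, for cochains $f\in\operatorname{Hom}_{E\text{-}E}(\Lambda^{\otimes n},\Lambda)$ and $g\in\operatorname{Hom}_{E\text{-}E}(\Lambda^{\otimes p},\Lambda)$ of the bar resolution, the cup product is $f\cup g=\sigma(f\otimes g)$, with $\sigma$ the multiplication of $\Lambda$, and the bracket is $[f,g]=f\circ g-(-1)^{(n-1)(p-1)}g\circ f$, where $f\circ g=\sum_{i=1}^n(-1)^{(i-1)(p-1)}f\circ_i g$ and $(f\circ_i g)(v_1\otimes\cdots\otimes v_{n+p-1})=f(v_1\otimes\cdots\otimes v_{i-1}\otimes g(v_i\otimes\cdots\otimes v_{i+p-1})\otimes v_{i+p}\otimes\cdots\otimes v_{n+p-1})$. These induce the cup product and Lie bracket making $\operatorname{HH}^*(\Lambda)$ a Gerstenhaber algebra. "The cup product is non-trivial" means that there are homogeneous classes of positive degree with non-zero cup product; "the Lie bracket is non-trivial" means that there are homogeneous classes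 of positive degree whose bracket is non-zero. *)

theory Defs
  imports
    "HOL-Algebra.QuotRing"
    "HOL-Computational_Algebra.Polynomial"
    "Jordan_Normal_Form.Matrix"
    "Graph_Theory.Graph_Theory"
begin

text \<open>
  The ground field is a type \<open>'k\<close> of sort \<open>alg_closed_field\<close>. A \<open>'k\<close>-algebra or
  \<open>'k\<close>-vector space is a \<open>('k, 'a) module\<close> record of HOL-Algebra; as usual there, the
  fields \<open>mult\<close> and \<open>one\<close> of a record that is only a vector space carry no meaning.
  Quivers are the finite multi-digraphs of Graph-Theory: \<open>tail\<close> is the source and
  \<open>head\<close> the target of an arrow.
\<close>

section \<open>Path algebras and gentle bound quivers\<close>

text \<open>
  A path is a pair (starting vertex, list of arrows); the pair \<open>(v, [])\<close> is the trivial
  path at \<open>v\<close>. Paths are composed from left to right.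
\<close>

type_synonym ('v, 'a) path = "'v \<times> 'a list"

definition quiver_paths :: "('v, 'a) pre_digraph \<Rightarrow> ('v, 'a) path set" where
  "quiver_paths Q = {(u, p). \<exists>v. pre_digraph.awalk Q u p v}"

definition path_algebra ::
  "('v, 'a) pre_digraph \<Rightarrow> ('k::field, ('v, 'a) path \<Rightarrow> 'k) module" where
  "path_algebra Q =
    \<lparr>carrier = {x. finite {w. x w \<noteq> 0} \<and> {w. x w \<noteq> 0} \<subseteq> quiver_paths Q},
     monoid.mult = (\<lambda>x y. \<lambda>(u, p). \<Sum>i\<le>length p.
               x (u, take i p) * y (pre_digraph.awlast Q u (take i p), drop i p)),
     one = (\<lambda>(u, p). if u \<in> verts Q \<and> p = [] then 1 else 0),
     ring.zero = (\<lambda>_. 0),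
     add = (\<lambda>x y w. x w + y w),
     smult = (\<lambda>c x w. c * x w)\<rparr>"

definition path_elem :: "('v, 'a) path \<Rightarrow> ('v, 'a) path \<Rightarrow> 'k::field" where
  "path_elem w = (\<lambda>w'. if w' = w then 1 else 0)"

text \<open>The product \<open>\<alpha>\<beta>\<close> of two arrows with \<open>t(\<alpha>) = s(\<beta>)\<close>.\<close>

definition arrow_prod ::
  "('v, 'a) pre_digraph \<Rightarrow> 'a \<Rightarrow> 'a \<Rightarrow> ('v, 'a) path \<Rightarrow> 'k::field" where
  "arrow_prod Q a b = path_elem (tail Q a, [a, b])"

text \<open>With \<open>J\<close> the ideal generated by the arrows: \<open>J\<^sup>N \<subseteq> I \<subseteq> J\<^sup>2\<close> for some \<open>N \<ge> 2\<close>.\<close>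

definition admissible_ideal ::
  "('v, 'a) pre_digraph \<Rightarrow> (('v, 'a) path \<Rightarrow> 'k::field) set \<Rightarrow> bool" where
  "admissible_ideal Q I \<longleftrightarrow>
     ideal I (path_algebra Q) \<and>
     (\<exists>N\<ge>2. \<forall>w\<in>quiver_paths Q. length (snd w) \<ge> N \<longrightarrow> path_elem w \<in> I) \<and>
     (\<forall>x\<in>I. \<forall>w. x w \<noteq> 0 \<longrightarrow> length (snd w) \<ge> 2)"

definition gentle_bound_quiver ::
  "('v, 'a) pre_digraph \<Rightarrow> (('v, 'a) path \<Rightarrow> 'k::field) set \<Rightarrow> bool" where
  "gentle_bound_quiver Q I \<longleftrightarrow>
     fin_digraph Q \<and> admissible_ideal Q I \<and>
     (\<exists>R \<subseteq> {w \<in> quiver_paths Q. length (snd w) = 2}.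
        I = genideal (path_algebra Q) (path_elem ` R)) \<and>
     (\<forall>v\<in>verts Q. card {a \<in> arcs Q. head Q a = v} \<le> 2 \<and> card {a \<in> arcs Q. tail Q a = v} \<le> 2) \<and>
     (\<forall>a\<in>arcs Q.
        card {b \<in> arcs Q. head Q a = tail Q b \<and> arrow_prod Q a b \<notin> I} \<le> 1 \<and>
        card {c \<in> arcs Q. head Q c = tail Q a \<and> arrow_prod Q c a \<notin> I} \<le> 1 \<and>
        card {b \<in> arcs Q. head Q a = tail Q b \<and> arrow_prod Q a b \<in> I} \<le> 1 \<and>
        card {c \<in> arcs Q. head Q c = tail Q a \<and> arrow_prod Q c a \<in> I} \<le> 1)"

text \<open>The cycle may pass through a vertex more than once, but its arrows are distinct.\<close>

definition saturated_cycle ::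
  "nat \<Rightarrow> ('v, 'a) pre_digraph \<Rightarrow> (('v, 'a) path \<Rightarrow> 'k::field) set \<Rightarrow> 'a list \<Rightarrow> bool" where
  "saturated_cycle m Q I c \<longleftrightarrow>
     length c = m + 2 \<and> distinct c \<and> (\<exists>u. pre_digraph.awalk Q u c u) \<and>
     (\<forall>i<m + 2. arrow_prod Q (c ! i) (c ! (Suc i mod (m + 2))) \<in> I)"

definition quotient_algebra ::
  "('k, 'a) module \<Rightarrow> 'a set \<Rightarrow> ('k, 'a set) module" where
  "quotient_algebra A I =
    \<lparr>carrier = carrier (A Quot I), monoid.mult = monoid.mult (A Quot I), one = one (A Quot I),
     ring.zero = ring.zero (A Quot I), add = add (A Quot I),
     smult = (\<lambda>c X. \<Union>x\<in>X. I +>\<^bsub>A\<^esub> (c \<odot>\<^bsub>A\<^esub> x))\<rparr>"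

definition bound_quiver_algebra ::
  "('v, 'a) pre_digraph \<Rightarrow> (('v, 'a) path \<Rightarrow> 'k::field) set
     \<Rightarrow> ('k, (('v, 'a) path \<Rightarrow> 'k) set) module" where
  "bound_quiver_algebra Q I = quotient_algebra (path_algebra Q) I"

text \<open>The subalgebra \<open>E = kQ\<^sub>0\<close> of \<open>kQ/I\<close> spanned by the trivial paths.\<close>

definition vertex_subalgebra ::
  "('v, 'a) pre_digraph \<Rightarrow> (('v, 'a) path \<Rightarrow> 'k::field) set
     \<Rightarrow> (('v, 'a) path \<Rightarrow> 'k) set set" where
  "vertex_subalgebra Q I =
     (\<lambda>x. I +>\<^bsub>path_algebra Q\<^esub> x) `
       {x \<in> carrier (path_algebra Q). \<forall>w. snd w \<noteq> [] \<longrightarrow> x w = 0}"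

definition algebra_iso :: "('k, 'a) module \<Rightarrow> ('k, 'b) module \<Rightarrow> bool" where
  "algebra_iso A B \<longleftrightarrow>
     (\<exists>h \<in> ring_iso A B. \<forall>c. \<forall>x\<in>carrier A. h (c \<odot>\<^bsub>A\<^esub> x) = c \<odot>\<^bsub>B\<^esub> h x)"

text \<open>
  The underlying graph is the Euclidean diagram with \<open>n \<ge> 2\<close> vertices that is a single cycle
  of \<open>n\<close> edges; for \<open>n = 2\<close> this is a double edge.
\<close>

definition type_A_tilde :: "('v, 'a) pre_digraph \<Rightarrow> bool" where
  "type_A_tilde D \<longleftrightarrow>
     (\<exists>n\<ge>2. \<exists>v a. bij_betw v {..<n::nat} (verts D) \<and> bij_betw a {..<n} (arcs D) \<and>
        (\<forall>i<n. {tail D (a i), head D (a i)} = {v i, v (Suc i mod n)}))"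

section \<open>Linear categories\<close>

record ('k, 'o, 'm) lincat =
  cat_obj :: "'o set"
  cat_hom :: "'o \<Rightarrow> 'o \<Rightarrow> ('k, 'm) module"
  cat_comp :: "'o \<Rightarrow> 'o \<Rightarrow> 'o \<Rightarrow> 'm \<Rightarrow> 'm \<Rightarrow> 'm"
    \<comment> \<open>\<open>cat_comp C X Y Z g f\<close> is \<open>g \<circ> f\<close> for \<open>f : X \<rightarrow> Y\<close> and \<open>g : Y \<rightarrow> Z\<close>\<close>
  cat_id :: "'o \<Rightarrow> 'm"

abbreviation morphs :: "('k, 'o, 'm) lincat \<Rightarrow> 'o \<Rightarrow> 'o \<Rightarrow> 'm set" where
  "morphs C X Y \<equiv> carrier (cat_hom C X Y)"

record ('o, 'm) endofun =
  fobj :: "'o \<Rightarrow> 'o"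
  fmor :: "'o \<Rightarrow> 'o \<Rightarrow> 'm \<Rightarrow> 'm"

definition endo_id :: "('o, 'm) endofun" where
  "endo_id = \<lparr>fobj = (\<lambda>X. X), fmor = (\<lambda>X Y f. f)\<rparr>"

definition endo_comp :: "('o, 'm) endofun \<Rightarrow> ('o, 'm) endofun \<Rightarrow> ('o, 'm) endofun" where
  "endo_comp G F =
    \<lparr>fobj = (\<lambda>X. fobj G (fobj F X)),
     fmor = (\<lambda>X Y f. fmor G (fobj F X) (fobj F Y) (fmor F X Y f))\<rparr>"

primrec endo_pow :: "('o, 'm) endofun \<Rightarrow> nat \<Rightarrow> ('o, 'm) endofun" where
  "endo_pow F 0 = endo_id"
| "endo_pow F (Suc n) = endo_comp F (endo_pow F n)"

definition lin_endofunctor :: "('k, 'o, 'm) lincat \<Rightarrow> ('o, 'm) endofun \<Rightarrow> bool" where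
  "lin_endofunctor C F \<longleftrightarrow>
     (\<forall>X\<in>cat_obj C. fobj F X \<in> cat_obj C \<and>
        fmor F X X (cat_id C X) = cat_id C (fobj F X)) \<and>
     (\<forall>X\<in>cat_obj C. \<forall>Y\<in>cat_obj C. \<forall>f\<in>morphs C X Y.
        fmor F X Y f \<in> morphs C (fobj F X) (fobj F Y) \<and>
        (\<forall>g\<in>morphs C X Y. fmor F X Y (f \<oplus>\<^bsub>cat_hom C X Y\<^esub> g) =
           fmor F X Y f \<oplus>\<^bsub>cat_hom C (fobj F X) (fobj F Y)\<^esub> fmor F X Y g) \<and>
        (\<forall>c. fmor F X Y (c \<odot>\<^bsub>cat_hom C X Y\<^esub> f) =
           c \<odot>\<^bsub>cat_hom C (fobj F X) (fobj F Y)\<^esub> fmor F X Y f) \<and>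
        (\<forall>Z\<in>cat_obj C. \<forall>g\<in>morphs C Y Z. fmor F X Z (cat_comp C X Y Z g f) =
           cat_comp C (fobj F X) (fobj F Y) (fobj F Z) (fmor F Y Z g) (fmor F X Y f)))"

definition cat_iso :: "('k, 'o, 'm) lincat \<Rightarrow> 'o \<Rightarrow> 'o \<Rightarrow> 'm \<Rightarrow> bool" where
  "cat_iso C X Y f \<longleftrightarrow> f \<in> morphs C X Y \<and>
     (\<exists>g\<in>morphs C Y X. cat_comp C X Y X g f = cat_id C X \<and> cat_comp C Y X Y f g = cat_id C Y)"

definition nat_isomorphic ::
  "('k, 'o, 'm) lincat \<Rightarrow> ('o, 'm) endofun \<Rightarrow> ('o, 'm) endofun \<Rightarrow> bool" where
  "nat_isomorphic C F G \<longleftrightarrow>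
     (\<exists>\<eta>. (\<forall>X\<in>cat_obj C. cat_iso C (fobj F X) (fobj G X) (\<eta> X)) \<and>
       (\<forall>X\<in>cat_obj C. \<forall>Y\<in>cat_obj C. \<forall>f\<in>morphs C X Y.
          cat_comp C (fobj F X) (fobj F Y) (fobj G Y) (\<eta> Y) (fmor F X Y f) =
          cat_comp C (fobj F X) (fobj G X) (fobj G Y) (fmor G X Y f) (\<eta> X)))"

definition quasi_inverse ::
  "('k, 'o, 'm) lincat \<Rightarrow> ('o, 'm) endofun \<Rightarrow> ('o, 'm) endofun \<Rightarrow> bool" where
  "quasi_inverse C F G \<longleftrightarrow> lin_endofunctor C F \<and> lin_endofunctor C G \<and>
     nat_isomorphic C (endo_comp G F) endo_id \<and> nat_isomorphic C (endo_comp F G) endo_id"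

definition dual_space :: "('k::field, 'm) module \<Rightarrow> ('m \<Rightarrow> 'k) set" where
  "dual_space V = {l \<in> extensional (carrier V).
     (\<forall>x\<in>carrier V. \<forall>y\<in>carrier V. l (x \<oplus>\<^bsub>V\<^esub> y) = l x + l y) \<and>
     (\<forall>c. \<forall>x\<in>carrier V. l (c \<odot>\<^bsub>V\<^esub> x) = c * l x)}"

text \<open>
  A Serre functor \<open>S\<close>: an autoequivalence with isomorphisms \<open>\<phi> X Y\<close> from \<open>Hom(Y, S X)\<close> to the
  dual of \<open>Hom(X, Y)\<close>, natural in \<open>X\<close> and \<open>Y\<close>.
\<close>

definition serre_functor :: "('k::field, 'o, 'm) lincat \<Rightarrow> ('o, 'm) endofun \<Rightarrow> bool" where
  "serre_functor C S \<longleftrightarrow> (\<exists>S'. quasi_inverse C S S') \<and>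
    (\<exists>\<phi>. 
      (\<forall>X\<in>cat_obj C. \<forall>Y\<in>cat_obj C.
         bij_betw (\<phi> X Y) (morphs C Y (fobj S X)) (dual_space (cat_hom C X Y)) \<and>
         (\<forall>f\<in>morphs C Y (fobj S X). \<forall>h\<in>morphs C X Y.
            (\<forall>f'\<in>morphs C Y (fobj S X).
               \<phi> X Y (f \<oplus>\<^bsub>cat_hom C Y (fobj S X)\<^esub> f') h = \<phi> X Y f h + \<phi> X Y f' h) \<and>
            (\<forall>c. \<phi> X Y (c \<odot>\<^bsub>cat_hom C Y (fobj S X)\<^esub> f) h = c * \<phi> X Y f h))) \<and>
      (\<forall>X\<in>cat_obj C. \<forall>X'\<in>cat_obj C. \<forall>Y\<in>cat_obj C.
         \<forall>f\<in>morphs C Y (fobj S X'). \<forall>u\<in>morphs C X' X. \<forall>h\<in>morphs C X Y.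
           \<phi> X Y (cat_comp C Y (fobj S X') (fobj S X) (fmor S X' X u) f) h =
           \<phi> X' Y f (cat_comp C X' X Y h u)) \<and>
      (\<forall>X\<in>cat_obj C. \<forall>Y\<in>cat_obj C. \<forall>Y'\<in>cat_obj C.
         \<forall>f\<in>morphs C Y' (fobj S X). \<forall>u\<in>morphs C Y Y'. \<forall>h\<in>morphs C X Y.
           \<phi> X Y (cat_comp C Y Y' (fobj S X) f u) h =
           \<phi> X Y' f (cat_comp C X Y Y' u h)))"

text \<open>
  The Auslander-Reiten translation \<open>\<tau>\<close> with respect to a shift functor \<open>\<Sigma>\<close> is determined, up to
  natural isomorphism, by Serre duality: \<open>\<Sigma>\<tau>\<close> is a Serre functor, that is,
  \<open>Hom(Y, \<tau>X[1])\<close> is naturally dual to \<open>Hom(X, Y)\<close>.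
\<close>

definition AR_translation ::
  "('k::field, 'o, 'm) lincat \<Rightarrow> ('o, 'm) endofun \<Rightarrow> ('o, 'm) endofun \<Rightarrow> bool" where
  "AR_translation C \<Sigma> \<tau> \<longleftrightarrow> lin_endofunctor C \<tau> \<and> serre_functor C (endo_comp \<Sigma> \<tau>)"

definition is_direct_sum :: "('k, 'o, 'm) lincat \<Rightarrow> 'o \<Rightarrow> 'o list \<Rightarrow> bool" where
  "is_direct_sum C Z Xs \<longleftrightarrow> Z \<in> cat_obj C \<and> set Xs \<subseteq> cat_obj C \<and>
     (\<exists>\<iota> \<pi>.
       (\<forall>i<length Xs. \<iota> i \<in> morphs C (Xs ! i) Z \<and> \<pi> i \<in> morphs C Z (Xs ! i)) \<and>
       (\<forall>i<length Xs. \<forall>j<length Xs. cat_comp C (Xs ! j) Z (Xs ! i) (\<pi> i) (\<iota> j) =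
          (if i = j then cat_id C (Xs ! i) else \<zero>\<^bsub>cat_hom C (Xs ! j) (Xs ! i)\<^esub>)) \<and>
       finsum (cat_hom C Z Z) (\<lambda>i. cat_comp C Z (Xs ! i) Z (\<iota> i) (\<pi> i)) {..<length Xs} =
         cat_id C Z)"

definition add_closure :: "('k, 'o, 'm) lincat \<Rightarrow> 'o \<Rightarrow> 'o set" where
  "add_closure C T =
     {X. \<exists>Z Y r. is_direct_sum C Z [X, Y] \<and> is_direct_sum C Z (replicate r T)}"

text \<open>No non-zero object occurs twice as a direct summand.\<close>

definition basic_object :: "('k, 'o, 'm) lincat \<Rightarrow> 'o \<Rightarrow> bool" where
  "basic_object C T \<longleftrightarrow>
     (\<forall>X Y. is_direct_sum C T [X, X, Y] \<longrightarrow> cat_id C X = \<zero>\<^bsub>cat_hom C X X\<^esub>)"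

definition endo_algebra :: "('k, 'o, 'm) lincat \<Rightarrow> 'o \<Rightarrow> ('k, 'm) module" where
  "endo_algebra C T = (cat_hom C T T)\<lparr>monoid.mult := cat_comp C T T T, one := cat_id C T\<rparr>"

section \<open>Orbit categories\<close>

text \<open>
  In the orbit category \<open>C/F\<close>, the space of morphisms from \<open>X\<close> to \<open>Y\<close> is the direct sum of the
  spaces \<open>Hom(X, F\<^sup>n Y)\<close> over all integers \<open>n\<close>. Since \<open>F\<close> is an autoequivalence, the
  component of degree \<open>n < 0\<close> can be realised without choosing an inverse of \<open>F\<close>, as
  \<open>Hom(F\<^bsup>-n\<^esup> X, Y)\<close>.
\<close>

abbreviation negp :: "int \<Rightarrow> nat" where "negp n \<equiv> nat (- n)"
abbreviation posp :: "int \<Rightarrow> nat" where "posp n \<equiv> nat n"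

definition orbit_piece ::
  "('k, 'o, 'm) lincat \<Rightarrow> ('o, 'm) endofun \<Rightarrow> 'o \<Rightarrow> 'o \<Rightarrow> int \<Rightarrow> ('k, 'm) module" where
  "orbit_piece C F X Y n =
     cat_hom C (fobj (endo_pow F (negp n)) X) (fobj (endo_pow F (posp n)) Y)"

definition orbit_hom ::
  "('k, 'o, 'm) lincat \<Rightarrow> ('o, 'm) endofun \<Rightarrow> 'o \<Rightarrow> 'o \<Rightarrow> ('k, int \<Rightarrow> 'm) module" where
  "orbit_hom C F X Y =
    \<lparr>carrier = {\<phi>. (\<forall>n. \<phi> n \<in> carrier (orbit_piece C F X Y n)) \<and>
                    finite {n. \<phi> n \<noteq> \<zero>\<^bsub>orbit_piece C F X Y n\<^esub>}},
     monoid.mult = undefined, one = undefined,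
     ring.zero = (\<lambda>n. \<zero>\<^bsub>orbit_piece C F X Y n\<^esub>),
     add = (\<lambda>\<phi> \<psi> n. \<phi> n \<oplus>\<^bsub>orbit_piece C F X Y n\<^esub> \<psi> n),
     smult = (\<lambda>c \<phi> n. c \<odot>\<^bsub>orbit_piece C F X Y n\<^esub> \<phi> n)\<rparr>"

text \<open>
  The composite of \<open>f\<close> of degree \<open>a\<close> and \<open>g\<close> of degree \<open>b\<close> is \<open>F\<^sup>a(g) \<circ> f\<close>. Writing
  \<open>f : F\<^sup>p X \<rightarrow> F\<^sup>q Y\<close> and \<open>g : F\<^sup>r Y \<rightarrow> F\<^sup>s Z\<close> with \<open>a = q - p\<close>, \<open>b = s - r\<close>, the morphism
  \<open>F\<^sup>q(g) \<circ> F\<^sup>r(f) : F\<^bsup>p+r\<^esup> X \<rightarrow> F\<^bsup>q+s\<^esup> Z\<close> is \<open>F\<^sup>k(h)\<close> for a unique \<open>h\<close> in the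
  component of degree \<open>a + b\<close>, because \<open>F\<close> is fully faithful.
\<close>

definition orbit_comp_piece ::
  "('k, 'o, 'm) lincat \<Rightarrow> ('o, 'm) endofun \<Rightarrow> 'o \<Rightarrow> 'o \<Rightarrow> 'o \<Rightarrow> int \<Rightarrow> int \<Rightarrow> 'm \<Rightarrow> 'm \<Rightarrow> 'm" where
  "orbit_comp_piece C F X Y Z a b g f =
     (let P = (\<lambda>n. endo_pow F n); p = negp a; q = posp a; r = negp b; s = posp b;
          k = p + r - negp (a + b)
      in THE h. h \<in> carrier (orbit_piece C F X Z (a + b)) \<and>
           fmor (P k) (fobj (P (negp (a + b))) X) (fobj (P (posp (a + b))) Z) h =
           cat_comp C (fobj (P (p + r)) X) (fobj (P (q + r)) Y) (fobj (P (q + s)) Z)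
             (fmor (P q) (fobj (P r) Y) (fobj (P s) Z) g)
             (fmor (P r) (fobj (P p) X) (fobj (P q) Y) f))"

definition orbit_category ::
  "('k, 'o, 'm) lincat \<Rightarrow> ('o, 'm) endofun \<Rightarrow> ('k, 'o, int \<Rightarrow> 'm) lincat" where
  "orbit_category C F =
    \<lparr>cat_obj = cat_obj C,
     cat_hom = orbit_hom C F,
     cat_comp = (\<lambda>X Y Z \<psi> \<phi> n.
       finsum (orbit_piece C F X Z n)
         (\<lambda>a. orbit_comp_piece C F X Y Z a (n - a) (\<psi> (n - a)) (\<phi> a))
         {a. \<phi> a \<noteq> \<zero>\<^bsub>orbit_piece C F X Y a\<^esub>}),
     cat_id = (\<lambda>X n. if n = 0 then cat_id C X else \<zero>\<^bsub>orbit_piece C F X X n\<^esub>)\<rparr>"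

section \<open>The bounded derived category of a finite-dimensional algebra\<close>

text \<open>
  A finite-dimensional (left) module over a \<open>'k\<close>-algebra \<open>H\<close> is taken to have an underlying
  space of column vectors \<open>'k\<^sup>n\<close>; every finite-dimensional module is isomorphic to one of these.
\<close>

record ('k, 'h) fdmod =
  mdim :: nat
  mact :: "'h \<Rightarrow> 'k mat"

definition is_fdmod :: "('k::field, 'h) module \<Rightarrow> ('k, 'h) fdmod \<Rightarrow> bool" where
  "is_fdmod H M \<longleftrightarrow>
     (\<forall>x\<in>carrier H. mact M x \<in> carrier_mat (mdim M) (mdim M)) \<and>
     mact M \<one>\<^bsub>H\<^esub> = 1\<^sub>m (mdim M) \<and>
     (\<forall>x\<in>carrier H. \<forall>y\<in>carrier H.
        mact M (x \<otimes>\<^bsub>H\<^esub> y) = mact M x * mact M y \<and>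
        mact M (x \<oplus>\<^bsub>H\<^esub> y) = mact M x + mact M y) \<and>
     (\<forall>c. \<forall>x\<in>carrier H. mact M (c \<odot>\<^bsub>H\<^esub> x) = c \<cdot>\<^sub>m mact M x)"

definition fdmod_hom ::
  "('k::field, 'h) module \<Rightarrow> ('k, 'h) fdmod \<Rightarrow> ('k, 'h) fdmod \<Rightarrow> 'k mat set" where
  "fdmod_hom H M N =
     {A \<in> carrier_mat (mdim N) (mdim M). \<forall>x\<in>carrier H. A * mact M x = mact N x * A}"

text \<open>Complexes are cohomologically graded: \<open>cdiff X i : X\<^sup>i \<rightarrow> X\<^bsup>i+1\<^esup>\<close>.\<close>

record ('k, 'h) cx =
  cmod :: "int \<Rightarrow> ('k, 'h) fdmod"
  cdiff :: "int \<Rightarrow> 'k mat"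

abbreviation cdim :: "('k, 'h) cx \<Rightarrow> int \<Rightarrow> nat" where
  "cdim X i \<equiv> mdim (cmod X i)"

definition is_bounded_cx :: "('k::field, 'h) module \<Rightarrow> ('k, 'h) cx \<Rightarrow> bool" where
  "is_bounded_cx H X \<longleftrightarrow>
     (\<forall>i. is_fdmod H (cmod X i)) \<and>
     (\<forall>i. cdiff X i \<in> fdmod_hom H (cmod X i) (cmod X (i + 1))) \<and>
     (\<forall>i. cdiff X (i + 1) * cdiff X i = 0\<^sub>m (cdim X (i + 2)) (cdim X i)) \<and>
     finite {i. cdim X i \<noteq> 0}"

definition chain_map ::
  "('k::field, 'h) module \<Rightarrow> ('k, 'h) cx \<Rightarrow> ('k, 'h) cx \<Rightarrow> (int \<Rightarrow> 'k mat) \<Rightarrow> bool" where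
  "chain_map H X Y f \<longleftrightarrow>
     (\<forall>i. f i \<in> fdmod_hom H (cmod X i) (cmod Y i)) \<and>
     (\<forall>i. cdiff Y i * f i = f (i + 1) * cdiff X i)"

definition homotopic ::
  "('k::field, 'h) module \<Rightarrow> ('k, 'h) cx \<Rightarrow> ('k, 'h) cx \<Rightarrow>
     (int \<Rightarrow> 'k mat) \<Rightarrow> (int \<Rightarrow> 'k mat) \<Rightarrow> bool" where
  "homotopic H X Y f g \<longleftrightarrow>
     (\<exists>h. (\<forall>i. h i \<in> fdmod_hom H (cmod X i) (cmod Y (i - 1))) \<and>
          (\<forall>i. f i - g i = cdiff Y (i - 1) * h i + h (i + 1) * cdiff X i))"

definition cocycles :: "('k::field, 'h) cx \<Rightarrow> int \<Rightarrow> 'k vec set" where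
  "cocycles X i = {z \<in> carrier_vec (cdim X i). cdiff X i *\<^sub>v z = 0\<^sub>v (cdim X (i + 1))}"

definition coboundaries :: "('k::field, 'h) cx \<Rightarrow> int \<Rightarrow> 'k vec set" where
  "coboundaries X i = (\<lambda>y. cdiff X (i - 1) *\<^sub>v y) ` carrier_vec (cdim X (i - 1))"

text \<open>The induced maps \<open>H\<^sup>i(X) \<rightarrow> H\<^sup>i(Y)\<close> are injective and surjective.\<close>

definition quasi_iso ::
  "('k::field, 'h) module \<Rightarrow> ('k, 'h) cx \<Rightarrow> ('k, 'h) cx \<Rightarrow> (int \<Rightarrow> 'k mat) \<Rightarrow> bool" where
  "quasi_iso H X Y f \<longleftrightarrow> chain_map H X Y f \<and>
     (\<forall>i. (\<forall>z\<in>cocycles X i. f i *\<^sub>v z \<in> coboundaries Y i \<longrightarrow> z \<in> coboundaries X i) \<and>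
          (\<forall>z\<in>cocycles Y i. \<exists>x\<in>cocycles X i. \<exists>y\<in>coboundaries Y i. z = f i *\<^sub>v x + y))"

abbreviation chain_comp ::
  "(int \<Rightarrow> 'k::field mat) \<Rightarrow> (int \<Rightarrow> 'k mat) \<Rightarrow> int \<Rightarrow> 'k mat" where
  "chain_comp g f \<equiv> (\<lambda>i. g i * f i)"

text \<open>
  The derived category is the localisation of the homotopy category at the quasi-isomorphisms.
  A morphism \<open>X \<rightarrow> Y\<close> is a class of roofs \<open>X \<leftarrow> W \<rightarrow> Y\<close> whose left leg is a quasi-isomorphism.
\<close>

record ('k, 'h) roof =
  apex :: "('k, 'h) cx"
  den :: "int \<Rightarrow> 'k mat"
  num :: "int \<Rightarrow> 'k mat"

definition is_roof ::
  "('k::field, 'h) module \<Rightarrow> ('k, 'h) cx \<Rightarrow> ('k, 'h) cx \<Rightarrow> ('k, 'h) roof \<Rightarrow> bool" where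
  "is_roof H X Y r \<longleftrightarrow> is_bounded_cx H (apex r) \<and>
     quasi_iso H (apex r) X (den r) \<and> chain_map H (apex r) Y (num r)"

definition roof_equiv ::
  "('k::field, 'h) module \<Rightarrow> ('k, 'h) cx \<Rightarrow> ('k, 'h) cx \<Rightarrow>
     ('k, 'h) roof \<Rightarrow> ('k, 'h) roof \<Rightarrow> bool" where
  "roof_equiv H X Y r r' \<longleftrightarrow> is_roof H X Y r \<and> is_roof H X Y r' \<and>
     (\<exists>W u v. is_bounded_cx H W \<and> chain_map H W (apex r) u \<and> chain_map H W (apex r') v \<and>
        quasi_iso H W X (chain_comp (den r) u) \<and>
        homotopic H W X (chain_comp (den r) u) (chain_comp (den r') v) \<and>
        homotopic H W Y (chain_comp (num r) u) (chain_comp (num r') v))"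

definition roof_class ::
  "('k::field, 'h) module \<Rightarrow> ('k, 'h) cx \<Rightarrow> ('k, 'h) cx \<Rightarrow> ('k, 'h) roof \<Rightarrow> ('k, 'h) roof set" where
  "roof_class H X Y r = {r'. roof_equiv H X Y r r'}"

definition chain_id :: "('k::field, 'h) cx \<Rightarrow> int \<Rightarrow> 'k mat" where
  "chain_id X = (\<lambda>i. 1\<^sub>m (cdim X i))"

definition derived_hom ::
  "('k::field, 'h) module \<Rightarrow> ('k, 'h) cx \<Rightarrow> ('k, 'h) cx \<Rightarrow> ('k, ('k, 'h) roof set) module" where
  "derived_hom H X Y =
    \<lparr>carrier = roof_class H X Y ` {r. is_roof H X Y r},
     monoid.mult = undefined, one = undefined,
     ring.zero = roof_class H X Y
       \<lparr>apex = X, den = chain_id X, num = (\<lambda>i. 0\<^sub>m (cdim Y i) (cdim X i))\<rparr>,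
     add = (\<lambda>\<phi> \<psi>. \<Union>{roof_class H X Y \<lparr>apex = W, den = s, num = (\<lambda>i. f i + g i)\<rparr> | W s f g.
              \<lparr>apex = W, den = s, num = f\<rparr> \<in> \<phi> \<and> \<lparr>apex = W, den = s, num = g\<rparr> \<in> \<psi>}),
     smult = (\<lambda>c \<phi>. \<Union>r\<in>\<phi>. roof_class H X Y (r\<lparr>num := (\<lambda>i. c \<cdot>\<^sub>m num r i)\<rparr>))\<rparr>"

definition derived_comp ::
  "('k::field, 'h) module \<Rightarrow> ('k, 'h) cx \<Rightarrow> ('k, 'h) cx \<Rightarrow> ('k, 'h) cx \<Rightarrow>
     ('k, 'h) roof set \<Rightarrow> ('k, 'h) roof set \<Rightarrow> ('k, 'h) roof set" where
  "derived_comp H X Y Z \<psi> \<phi> =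
     \<Union>{roof_class H X Z \<lparr>apex = W, den = chain_comp (den r) u, num = chain_comp (num r') v\<rparr> |
         r r' W u v. r \<in> \<phi> \<and> r' \<in> \<psi> \<and> is_bounded_cx H W \<and>
           quasi_iso H W (apex r) u \<and> chain_map H W (apex r') v \<and>
           homotopic H W Y (chain_comp (num r) u) (chain_comp (den r') v)}"

definition derived_category ::
  "('k::field, 'h) module \<Rightarrow> ('k, ('k, 'h) cx, ('k, 'h) roof set) lincat" where
  "derived_category H =
    \<lparr>cat_obj = {X. is_bounded_cx H X},
     cat_hom = derived_hom H,
     cat_comp = derived_comp H,
     cat_id = (\<lambda>X. roof_class H X X \<lparr>apex = X, den = chain_id X, num = chain_id X\<rparr>)\<rparr>"

definition cx_shift :: "('k::field, 'h) cx \<Rightarrow> ('k, 'h) cx" where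
  "cx_shift X = \<lparr>cmod = (\<lambda>i. cmod X (i + 1)), cdiff = (\<lambda>i. - cdiff X (i + 1))\<rparr>"

definition roof_shift :: "('k::field, 'h) roof \<Rightarrow> ('k, 'h) roof" where
  "roof_shift r =
    \<lparr>apex = cx_shift (apex r), den = (\<lambda>i. den r (i + 1)), num = (\<lambda>i. num r (i + 1))\<rparr>"

definition shift_functor :: "(('k::field, 'h) cx, ('k, 'h) roof set) endofun" where
  "shift_functor = \<lparr>fobj = cx_shift, fmor = (\<lambda>X Y \<phi>. roof_shift ` \<phi>)\<rparr>"

section \<open>\<open>m\<close>-cluster tilted algebras\<close>

text \<open>
  The argument \<open>\<sigma>\<close> is the inverse of the Auslander-Reiten translation; the orbit category is
  formed with respect to \<open>\<sigma> \<circ> [m]\<close>.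
\<close>

definition cluster_category ::
  "nat \<Rightarrow> ('k::field, 'h) module \<Rightarrow> (('k, 'h) cx, ('k, 'h) roof set) endofun \<Rightarrow>
     ('k, ('k, 'h) cx, int \<Rightarrow> ('k, 'h) roof set) lincat" where
  "cluster_category m H \<sigma> =
     orbit_category (derived_category H) (endo_comp \<sigma> (endo_pow shift_functor m))"

text \<open>\<open>Ext\<^sup>i(T, X) = Hom(T, X[i])\<close> in the cluster category.\<close>

definition cluster_tilting ::
  "nat \<Rightarrow> ('k::field, 'h) module \<Rightarrow> (('k, 'h) cx, ('k, 'h) roof set) endofun \<Rightarrow>
     ('k, 'h) cx \<Rightarrow> bool" where
  "cluster_tilting m H \<sigma> T \<longleftrightarrow>
     (let C = cluster_category m H \<sigma> in
       T \<in> cat_obj C \<and> basic_object C T \<and>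
       (\<forall>X\<in>cat_obj C.
          (\<forall>i\<in>{1..m}. let Xi = (cx_shift ^^ i) X in morphs C T Xi = {\<zero>\<^bsub>cat_hom C T Xi\<^esub>})
          \<longleftrightarrow> X \<in> add_closure C T))"

definition cluster_tilted_algebra ::
  "nat \<Rightarrow> ('k::field, 'h) module \<Rightarrow> ('k, 'a) module \<Rightarrow> bool" where
  "cluster_tilted_algebra m H A \<longleftrightarrow>
     (\<exists>\<tau> \<sigma> T. AR_translation (derived_category H) shift_functor \<tau> \<and>
        quasi_inverse (derived_category H) \<tau> \<sigma> \<and>
        cluster_tilting m H \<sigma> T \<and>
        algebra_iso A (endo_algebra (cluster_category m H \<sigma>) T))"

section \<open>Hochschild cohomology\<close>

text \<open>
  Throughout, \<open>A\<close> is a \<open>'k\<close>-algebra and \<open>E\<close> a subalgebra. Tensor products are over \<open>E\<close>. An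
  \<open>E\<close>-bimodule map from the \<open>n\<close>-th tensor power of \<open>A\<close> to \<open>A\<close> is represented by the
  corresponding additive, \<open>E\<close>-balanced and \<open>E\<close>-bilinear function on \<open>n\<close>-tuples (lists of length
  \<open>n\<close>). For \<open>n = 0\<close> this is the image of \<open>1 \<in> E\<close>, an element of \<open>A\<close> that commutes with \<open>E\<close>.
  Since \<open>E\<close> contains the scalars, such functions are \<open>'k\<close>-multilinear.
  When \<open>E\<close> is separable over \<open>'k\<close>, as the span of the trivial paths is, these functions form
  the complex obtained from the bar resolution of the bimodule \<open>A\<close> relative to \<open>E\<close>, a projective
  resolution; its cohomology is the self-extension groups of \<open>A\<close> as a bimodule.
\<close>

definition tuples :: "('k, 'a) module \<Rightarrow> nat \<Rightarrow> 'a list set" where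
  "tuples A n = {vs. length vs = n \<and> set vs \<subseteq> carrier A}"

definition hh_cochains ::
  "('k, 'a) module \<Rightarrow> 'a set \<Rightarrow> nat \<Rightarrow> ('a list \<Rightarrow> 'a) set" where
  "hh_cochains A E n = {f \<in> tuples A n \<rightarrow>\<^sub>E carrier A.
     (\<forall>us ws. \<forall>x\<in>carrier A. \<forall>y\<in>carrier A. us @ x # ws \<in> tuples A n \<longrightarrow>
        f (us @ (x \<oplus>\<^bsub>A\<^esub> y) # ws) = f (us @ x # ws) \<oplus>\<^bsub>A\<^esub> f (us @ y # ws)) \<and>
     (\<forall>us ws x y. \<forall>e\<in>E. us @ x # y # ws \<in> tuples A n \<longrightarrow>
        f (us @ (x \<otimes>\<^bsub>A\<^esub> e) # y # ws) = f (us @ x # (e \<otimes>\<^bsub>A\<^esub> y) # ws)) \<and>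
     (\<forall>x ws. \<forall>e\<in>E. x # ws \<in> tuples A n \<longrightarrow>
        f ((e \<otimes>\<^bsub>A\<^esub> x) # ws) = e \<otimes>\<^bsub>A\<^esub> f (x # ws)) \<and>
     (\<forall>us x. \<forall>e\<in>E. us @ [x] \<in> tuples A n \<longrightarrow>
        f (us @ [x \<otimes>\<^bsub>A\<^esub> e]) = f (us @ [x]) \<otimes>\<^bsub>A\<^esub> e) \<and>
     (n = 0 \<longrightarrow> (\<forall>e\<in>E. e \<otimes>\<^bsub>A\<^esub> f [] = f [] \<otimes>\<^bsub>A\<^esub> e))}"

definition hh_cochain_space ::
  "('k, 'a) module \<Rightarrow> 'a set \<Rightarrow> nat \<Rightarrow> ('k, 'a list \<Rightarrow> 'a) module" where
  "hh_cochain_space A E n =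
    \<lparr>carrier = hh_cochains A E n, monoid.mult = undefined, one = undefined,
     ring.zero = (\<lambda>vs\<in>tuples A n. \<zero>\<^bsub>A\<^esub>),
     add = (\<lambda>f g. \<lambda>vs\<in>tuples A n. f vs \<oplus>\<^bsub>A\<^esub> g vs),
     smult = (\<lambda>c f. \<lambda>vs\<in>tuples A n. c \<odot>\<^bsub>A\<^esub> f vs)\<rparr>"

definition hh_diff ::
  "('k::field, 'a) module \<Rightarrow> nat \<Rightarrow> ('a list \<Rightarrow> 'a) \<Rightarrow> 'a list \<Rightarrow> 'a" where
  "hh_diff A n f = (\<lambda>vs\<in>tuples A (n + 1).
     hd vs \<otimes>\<^bsub>A\<^esub> f (tl vs) \<oplus>\<^bsub>A\<^esub>
     finsum A (\<lambda>i. (- 1) ^ i \<odot>\<^bsub>A\<^esub>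
       f (take (i - 1) vs @ (vs ! (i - 1) \<otimes>\<^bsub>A\<^esub> vs ! i) # drop (i + 1) vs)) {1..n} \<oplus>\<^bsub>A\<^esub>
     (- 1) ^ (n + 1) \<odot>\<^bsub>A\<^esub> (f (butlast vs) \<otimes>\<^bsub>A\<^esub> last vs))"

definition hh_cocycles ::
  "('k::field, 'a) module \<Rightarrow> 'a set \<Rightarrow> nat \<Rightarrow> ('a list \<Rightarrow> 'a) set" where
  "hh_cocycles A E n =
     {f \<in> hh_cochains A E n. hh_diff A n f = \<zero>\<^bsub>hh_cochain_space A E (n + 1)\<^esub>}"

definition hh_coboundaries ::
  "('k::field, 'a) module \<Rightarrow> 'a set \<Rightarrow> nat \<Rightarrow> ('a list \<Rightarrow> 'a) set" where
  "hh_coboundaries A E n =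
     (if n = 0 then {\<zero>\<^bsub>hh_cochain_space A E 0\<^esub>}
      else hh_diff A (n - 1) ` hh_cochains A E (n - 1))"

definition hh_class ::
  "('k::field, 'a) module \<Rightarrow> 'a set \<Rightarrow> nat \<Rightarrow> ('a list \<Rightarrow> 'a) \<Rightarrow> ('a list \<Rightarrow> 'a) set" where
  "hh_class A E n f = hh_coboundaries A E n +>\<^bsub>hh_cochain_space A E n\<^esub> f"

definition HH ::
  "('k::field, 'a) module \<Rightarrow> 'a set \<Rightarrow> nat \<Rightarrow> ('a list \<Rightarrow> 'a) set set" where
  "HH A E n = hh_class A E n ` hh_cocycles A E n"

definition HH_zero ::
  "('k::field, 'a) module \<Rightarrow> 'a set \<Rightarrow> nat \<Rightarrow> ('a list \<Rightarrow> 'a) set" where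
  "HH_zero A E n = hh_class A E n \<zero>\<^bsub>hh_cochain_space A E n\<^esub>"

definition cup ::
  "('k, 'a) module \<Rightarrow> nat \<Rightarrow> nat \<Rightarrow> ('a list \<Rightarrow> 'a) \<Rightarrow> ('a list \<Rightarrow> 'a) \<Rightarrow> 'a list \<Rightarrow> 'a" where
  "cup A n p f g = (\<lambda>vs\<in>tuples A (n + p). f (take n vs) \<otimes>\<^bsub>A\<^esub> g (drop n vs))"

text \<open>
  In the signs below, \<open>n - 1\<close>, \<open>p - 1\<close> and \<open>i - 1\<close> are replaced by \<open>n + 1\<close>, \<open>p + 1\<close> and
  \<open>i + 1\<close>, which have the same parity, to avoid truncated subtraction. The composition and the
  bracket are of degree \<open>n + p - 1\<close> and are used only for \<open>n, p \<ge> 1\<close>.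
\<close>

definition circ_at ::
  "nat \<Rightarrow> nat \<Rightarrow> ('a list \<Rightarrow> 'a) \<Rightarrow> ('a list \<Rightarrow> 'a) \<Rightarrow> 'a list \<Rightarrow> 'a" where
  "circ_at p i f g vs =
     f (take (i - 1) vs @ g (take p (drop (i - 1) vs)) # drop (i - 1 + p) vs)"

definition circ ::
  "('k::field, 'a) module \<Rightarrow> nat \<Rightarrow> nat \<Rightarrow> ('a list \<Rightarrow> 'a) \<Rightarrow> ('a list \<Rightarrow> 'a) \<Rightarrow> 'a list \<Rightarrow> 'a" where
  "circ A n p f g = (\<lambda>vs\<in>tuples A (n + p - 1).
     finsum A (\<lambda>i. (- 1) ^ ((i + 1) * (p + 1)) \<odot>\<^bsub>A\<^esub> circ_at p i f g vs) {1..n})"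

definition gerst_bracket ::
  "('k::field, 'a) module \<Rightarrow> nat \<Rightarrow> nat \<Rightarrow> ('a list \<Rightarrow> 'a) \<Rightarrow> ('a list \<Rightarrow> 'a) \<Rightarrow> 'a list \<Rightarrow> 'a" where
  "gerst_bracket A n p f g = (\<lambda>vs\<in>tuples A (n + p - 1).
     circ A n p f g vs \<ominus>\<^bsub>A\<^esub> (- 1) ^ ((n + 1) * (p + 1)) \<odot>\<^bsub>A\<^esub> circ A p n g f vs)"

definition HH_cup ::
  "('k::field, 'a) module \<Rightarrow> 'a set \<Rightarrow> nat \<Rightarrow> nat \<Rightarrow>
     ('a list \<Rightarrow> 'a) set \<Rightarrow> ('a list \<Rightarrow> 'a) set \<Rightarrow> ('a list \<Rightarrow> 'a) set" where
  "HH_cup A E n p x y = (\<Union>f\<in>x. \<Union>g\<in>y. hh_class A E (n + p) (cup A n p f g))"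

definition HH_bracket ::
  "('k::field, 'a) module \<Rightarrow> 'a set \<Rightarrow> nat \<Rightarrow> nat \<Rightarrow>
     ('a list \<Rightarrow> 'a) set \<Rightarrow> ('a list \<Rightarrow> 'a) set \<Rightarrow> ('a list \<Rightarrow> 'a) set" where
  "HH_bracket A E n p x y = (\<Union>f\<in>x. \<Union>g\<in>y. hh_class A E (n + p - 1) (gerst_bracket A n p f g))"

definition cup_nontrivial :: "('k::field, 'a) module \<Rightarrow> 'a set \<Rightarrow> bool" where
  "cup_nontrivial A E \<longleftrightarrow>
     (\<exists>n\<ge>1. \<exists>p\<ge>1. \<exists>x\<in>HH A E n. \<exists>y\<in>HH A E p. HH_cup A E n p x y \<noteq> HH_zero A E (n + p))"

definition bracket_nontrivial :: "('k::field, 'a) module \<Rightarrow> 'a set \<Rightarrow> bool" where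
  "bracket_nontrivial A E \<longleftrightarrow>
     (\<exists>n\<ge>1. \<exists>p\<ge>1. \<exists>x\<in>HH A E n. \<exists>y\<in>HH A E p.
        HH_bracket A E n p x y \<noteq> HH_zero A E (n + p - 1))"

end

theory Submission
  imports Defs
begin

text \<open>
  Let \<open>c\<^sub>0, \<dots>, c\<^sub>N\<^sub>-\<^sub>1\<close> be the arrows of a saturated cycle, with \<open>N = m + 2\<close> and indices read modulo
  \<open>N\<close>. The Koszul resolution of the quadratic monomial algebra \<open>\<Lambda>\<close> has in degree \<open>n\<close> the paths of
  length \<open>n\<close> in which any two consecutive arrows compose to a relation. By gentleness an arrow has
  at most one continuation of this kind on either side, so such a path that meets the cycle never
  leaves it. Hence the cochain of degree \<open>2 N\<close> that sends the path \<open>c\<^sub>j c\<^sub>j\<^sub>+\<^sub>1 \<dots>\<close> of length \<open>2 N\<close>, for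
  every \<open>j\<close>, to the vertex \<open>s(c\<^sub>j)\<close>, and all other paths to zero, has a coboundary supported on
  the paths of length \<open>2 N + 1\<close> around the cycle, where its value is \<open>c\<^sub>j - c\<^sub>j = 0\<close>. (Going round the
  cycle twice makes the degree even; for \<open>N\<close> odd, going round once would give \<open>2 c\<^sub>j\<close>.)

  This cocycle \<open>f\<close> takes vertices as values, whereas a coboundary, evaluated at arrows with
  vanishing consecutive products, takes values in the radical. So \<open>f\<close> is not a coboundary, and
  neither is \<open>f \<union> f\<close>, whose value going round the cycle four times is again a vertex: the cup
  product is non-trivial. If \<open>D\<close> is the Euler derivation, which multiplies a path by its length,
  then \<open>[D, f]\<close> and \<open>- 2 N f\<close> agree on the cycle because \<open>f\<close> lowers the length by \<open>2 N\<close>; in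
  characteristic zero this is not a coboundary by the same test, and the bracket is non-trivial.

  On the bar complex, the composite of \<open>f\<close> with the comparison map to the Koszul resolution is
  \<open>f(x\<^sub>1, \<dots>, x\<^sub>n) = \<Sum>\<^sub>j R\<^sub>j(x\<^sub>1) \<phi>\<^sub>j\<^sub>+\<^sub>1(x\<^sub>2) \<phi>\<^sub>j\<^sub>+\<^sub>2(x\<^sub>3) \<cdots> L\<^sub>j\<^sub>+\<^sub>n\<^sub>-\<^sub>1(x\<^sub>n)\<close>  with \<open>n = 2 N\<close>,
  where \<open>\<phi>\<^sub>j\<close> is the coefficient of the arrow \<open>c\<^sub>j\<close>, and \<open>R\<^sub>j\<close> and \<open>L\<^sub>j\<close> strip \<open>c\<^sub>j\<close> off the right and
  left end of a path (and kill the paths that do not end or begin with \<open>c\<^sub>j\<close>). These operators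
  satisfy Leibniz rules with a correction term coming from the relation between \<open>c\<^sub>j\<close> and \<open>c\<^sub>j\<^sub>+\<^sub>1\<close>
  (\<open>strip_left_mult\<close>, \<open>strip_right_mult\<close>); the differential of \<open>f\<close> telescopes, and the two
  correction terms that remain at its ends cancel (\<open>cycle_cochain_cocycle\<close>). The test for
  coboundaries is \<open>HH_zero_augmentation\<close>, and the value on the cycle is
  \<open>base_cycle_cochain_walk\<close>.
\<close>

section \<open>Hochschild cochains of an algebra with coordinates\<close>

text \<open>
  Linear forms \<open>coef w\<close> that separate the points of \<open>A\<close> turn identities in \<open>A\<close>, where finite sums
  and signs live in a record, into identities between elements of the type \<open>'k\<close>.
\<close>

locale coordinate_algebra = ring A
  for A :: "('k::field, 'x) module" (structure) +
  fixes coef :: "'w \<Rightarrow> 'x \<Rightarrow> 'k"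
  assumes smult_closed [simp, intro]: "x \<in> carrier A \<Longrightarrow> c \<odot> x \<in> carrier A"
    and coef_add [simp]: "\<lbrakk>x \<in> carrier A; y \<in> carrier A\<rbrakk> \<Longrightarrow> coef w (x \<oplus> y) = coef w x + coef w y"
    and coef_smult [simp]: "x \<in> carrier A \<Longrightarrow> coef w (c \<odot> x) = c * coef w x"
    and coef_eqI: "\<lbrakk>x \<in> carrier A; y \<in> carrier A; \<And>w. coef w x = coef w y\<rbrakk> \<Longrightarrow> x = y"
    and smult_mult: "\<lbrakk>x \<in> carrier A; y \<in> carrier A\<rbrakk> \<Longrightarrow> (c \<odot> x) \<otimes> y = c \<odot> (x \<otimes> y)"
    and mult_smult: "\<lbrakk>x \<in> carrier A; y \<in> carrier A\<rbrakk> \<Longrightarrow> x \<otimes> (c \<odot> y) = c \<odot> (x \<otimes> y)"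
begin

lemma coef_zero [simp]: "coef w \<zero> = 0"
proof -
  have "coef w (\<zero> \<oplus> \<zero>) = coef w \<zero> + coef w \<zero>" by (rule coef_add) simp_all
  then show ?thesis by (metis add_cancel_right_right l_zero zero_closed)
qed

lemma coef_minus [simp]: "\<lbrakk>x \<in> carrier A; y \<in> carrier A\<rbrakk> \<Longrightarrow> coef w (x \<ominus> y) = coef w x - coef w y"
  by (metis add.inv_solve_right coef_add minus_closed a_minus_def add_diff_cancel_right')

lemma coef_finsum [simp]:
  "finite S \<Longrightarrow> (\<And>i. i \<in> S \<Longrightarrow> g i \<in> carrier A) \<Longrightarrow>
    coef w (finsum A g S) = (\<Sum>i\<in>S. coef w (g i))"
  by (induction S rule: finite_induct) (simp_all add: Pi_iff)

lemma tuples_Cons [simp]: "x # vs \<in> tuples A (Suc n) \<longleftrightarrow> x \<in> carrier A \<and> vs \<in> tuples A n"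
  by (auto simp: tuples_def)

lemma tuples_Nil [simp]: "[] \<in> tuples A n \<longleftrightarrow> n = 0"
  by (auto simp: tuples_def)

end

text \<open>
  The arguments of the \<open>i\<close>-th inner term of the Hochschild differential; the positions are counted
  from \<open>1\<close>, so that this multiplies the \<open>i\<close>-th and the \<open>i + 1\<close>-st entry.
\<close>

definition contract :: "('k, 'x) module \<Rightarrow> nat \<Rightarrow> 'x list \<Rightarrow> 'x list" where
  "contract A i vs = take (i - 1) vs @ (vs ! (i - 1) \<otimes>\<^bsub>A\<^esub> vs ! i) # drop (i + 1) vs"

context coordinate_algebra
begin

lemma contract_tuples:
  assumes "vs \<in> tuples A (Suc n)" "1 \<le> i" "i \<le> n"
  shows "contract A i vs \<in> tuples A n"
proof -
  have "set vs \<subseteq> carrier A" "length vs = Suc n" using assms by (auto simp: tuples_def)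
  moreover from this have "vs ! (i - 1) \<in> carrier A" "vs ! i \<in> carrier A"
    using assms by (auto simp: subset_iff)
  ultimately show ?thesis
    using assms set_take_subset[of "i - 1" vs] set_drop_subset[of "i + 1" vs]
    by (auto simp: tuples_def contract_def)
qed

lemma tuples_ends:
  assumes "vs \<in> tuples A (Suc n)"
  shows "hd vs \<in> carrier A" "tl vs \<in> tuples A n" "butlast vs \<in> tuples A n" "last vs \<in> carrier A"
proof -
  have *: "set vs \<subseteq> carrier A" "length vs = Suc n" using assms by (auto simp: tuples_def)
  then have "vs \<noteq> []" by auto
  then show "hd vs \<in> carrier A" "last vs \<in> carrier A" using * by auto
  show "tl vs \<in> tuples A n" "butlast vs \<in> tuples A n"
    using * \<open>vs \<noteq> []\<close> by (auto simp: tuples_def dest: list.set_sel(2) in_set_butlastD)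
qed

lemma hh_diff_eq:
  assumes "vs \<in> tuples A (Suc n)"
  shows "hh_diff A n f vs =
    hd vs \<otimes> f (tl vs) \<oplus> finsum A (\<lambda>i. (- 1) ^ i \<odot> f (contract A i vs)) {1..n} \<oplus>
    (- 1) ^ (n + 1) \<odot> (f (butlast vs) \<otimes> last vs)"
  using assms by (simp add: hh_diff_def contract_def)

lemma
  assumes "f \<in> tuples A n \<rightarrow> carrier A" and vs: "vs \<in> tuples A (Suc n)"
  shows hh_diff_closed: "hh_diff A n f vs \<in> carrier A"
    and coef_hh_diff: "coef w (hh_diff A n f vs) =
      coef w (hd vs \<otimes> f (tl vs)) + (\<Sum>i=1..n. (- 1) ^ i * coef w (f (contract A i vs))) +
      (- 1) ^ (n + 1) * coef w (f (butlast vs) \<otimes> last vs)"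
proof -
  have inner: "f (contract A i vs) \<in> carrier A" if "i \<in> {1..n}" for i
    using contract_tuples[OF vs, of i] that assms(1) by auto
  have ends: "hd vs \<otimes> f (tl vs) \<in> carrier A" "f (butlast vs) \<otimes> last vs \<in> carrier A"
    using tuples_ends[OF vs] assms(1) by auto
  have sum_closed: "finsum A (\<lambda>i. (- 1) ^ i \<odot> f (contract A i vs)) {1..n} \<in> carrier A"
    using inner by (intro finsum_closed) auto
  have "coef w (finsum A (\<lambda>i. (- 1) ^ i \<odot> f (contract A i vs)) {1..n}) =
      (\<Sum>i=1..n. (- 1) ^ i * coef w (f (contract A i vs)))"
    by (subst coef_finsum) (use inner in \<open>auto intro!: sum.cong\<close>)
  then show "coef w (hh_diff A n f vs) =
      coef w (hd vs \<otimes> f (tl vs)) + (\<Sum>i=1..n. (- 1) ^ i * coef w (f (contract A i vs))) +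
      (- 1) ^ (n + 1) * coef w (f (butlast vs) \<otimes> last vs)"
    using ends sum_closed unfolding hh_diff_eq[OF vs] by (simp del: One_nat_def)
  show "hh_diff A n f vs \<in> carrier A"
    using ends sum_closed unfolding hh_diff_eq[OF vs] by (simp del: One_nat_def)
qed

lemma contract_Cons:
  "1 \<le> i \<Longrightarrow> contract A (Suc i) (x # vs) = x # contract A i vs"
  by (cases i) (auto simp: contract_def)

lemma hh_cocyclesI:
  assumes "f \<in> hh_cochains A E n"
    and "\<And>vs w. vs \<in> tuples A (Suc n) \<Longrightarrow>
      coef w (hd vs \<otimes> f (tl vs)) + (\<Sum>i=1..n. (- 1) ^ i * coef w (f (contract A i vs))) +
      (- 1) ^ (n + 1) * coef w (f (butlast vs) \<otimes> last vs) = 0"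
  shows "f \<in> hh_cocycles A E n"
proof -
  have f: "f \<in> tuples A n \<rightarrow> carrier A" using assms(1) by (auto simp: hh_cochains_def)
  have "hh_diff A n f vs = \<zero>\<^bsub>hh_cochain_space A E (n + 1)\<^esub> vs" for vs
  proof (cases "vs \<in> tuples A (Suc n)")
    case True
    have "hh_diff A n f vs = \<zero>"
      using True f by (intro coef_eqI) (simp_all only: hh_diff_closed zero_closed coef_zero
          coef_hh_diff assms(2))
    then show ?thesis using True by (simp add: hh_cochain_space_def)
  qed (simp add: hh_diff_def hh_cochain_space_def)
  then show ?thesis using assms(1) by (auto simp: hh_cocycles_def)
qed

lemma cochain_map: "f \<in> hh_cochains A E n \<Longrightarrow> f \<in> tuples A n \<rightarrow>\<^sub>E carrier A"
  by (simp add: hh_cochains_def)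

lemma zero_cochain_coboundary:
  assumes "E \<subseteq> carrier A" "n \<ge> 1"
  shows "\<zero>\<^bsub>hh_cochain_space A E n\<^esub> \<in> hh_coboundaries A E n"
proof -
  define z where "z = (\<lambda>vs\<in>tuples A (n - 1). \<zero>)"
  have z: "z \<in> hh_cochains A E (n - 1)"
    using assms(1) unfolding hh_cochains_def z_def
    by (fastforce simp: tuples_def)
  have z': "z \<in> tuples A (n - 1) \<rightarrow> carrier A"
    by (auto simp: z_def)
  have "hh_diff A (n - 1) z vs = \<zero>\<^bsub>hh_cochain_space A E n\<^esub> vs" for vs
  proof (cases "vs \<in> tuples A n")
    case True
    then have vs: "vs \<in> tuples A (Suc (n - 1))" using assms by simp
    have "hh_diff A (n - 1) z vs = \<zero>"
    proof (rule coef_eqI)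
      show "hh_diff A (n - 1) z vs \<in> carrier A" by (rule hh_diff_closed[OF z' vs])
      have "z (contract A i vs) = \<zero>" if "i \<in> {1..n-1}" for i
        using contract_tuples[OF vs, of i] that by (simp add: z_def)
      then show "coef w (hh_diff A (n - 1) z vs) = coef w \<zero>" for w
        using tuples_ends[OF vs] by (simp add: coef_hh_diff[OF z' vs] del: One_nat_def) (simp add: z_def)
    qed simp
    then show ?thesis using True by (simp add: hh_cochain_space_def)
  next
    case False
    then show ?thesis using assms by (simp add: hh_diff_def hh_cochain_space_def)
  qed
  then show ?thesis
    using z assms by (auto simp: hh_coboundaries_def image_iff fun_eq_iff intro!: bexI[of _ z])
qed

lemma self_in_hh_class:
  assumes "E \<subseteq> carrier A" "n \<ge> 1" "f \<in> tuples A n \<rightarrow>\<^sub>E carrier A"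
  shows "f \<in> hh_class A E n f"
proof -
  have "f vs = (\<zero>\<^bsub>hh_cochain_space A E n\<^esub> \<oplus>\<^bsub>hh_cochain_space A E n\<^esub> f) vs" for vs
    using assms(3) by (auto simp: hh_cochain_space_def PiE_def Pi_iff extensional_def)
  then have "f = \<zero>\<^bsub>hh_cochain_space A E n\<^esub> \<oplus>\<^bsub>hh_cochain_space A E n\<^esub> f" ..
  then show ?thesis
    unfolding hh_class_def a_r_coset_def' using zero_cochain_coboundary[OF assms(1,2)] by blast
qed

lemma cochain_zero_argument:
  assumes "f \<in> hh_cochains A E n" "us @ \<zero> # ws \<in> tuples A n"
  shows "f (us @ \<zero> # ws) = \<zero>"
proof -
  have "f (us @ (\<zero> \<oplus> \<zero>) # ws) = f (us @ \<zero> # ws) \<oplus> f (us @ \<zero> # ws)"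
    using assms zero_closed unfolding hh_cochains_def by blast
  moreover have "f (us @ \<zero> # ws) \<in> carrier A"
    using assms unfolding hh_cochains_def by blast
  ultimately show ?thesis by (simp add: l_zero add.l_cancel_one')
qed

text \<open>
  In \<open>v\<^sub>1 h(v\<^sub>2, \<dots>) - h(v\<^sub>1 v\<^sub>2, \<dots>) + \<dots> \<plusminus> h(\<dots>) v\<^sub>n\<close> the inner terms vanish because the consecutive
  products do, and the two outer ones lie in the kernel of every multiplicative form that kills
  the \<open>v\<^sub>i\<close>. Over a bound quiver algebra such a form is the coefficient of a vertex.
\<close>

lemma HH_zero_augmentation:
  assumes g: "g \<in> HH_zero A E n" and "n \<ge> 1"
    and vs: "vs \<in> tuples A n"
    and consecutive: "\<And>i. Suc i < n \<Longrightarrow> vs ! i \<otimes> vs ! Suc i = \<zero>"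
    and mult: "\<And>x y. x \<in> carrier A \<Longrightarrow> y \<in> carrier A \<Longrightarrow> coef w (x \<otimes> y) = coef w x * coef w y"
    and "\<And>x. x \<in> set vs \<Longrightarrow> coef w x = 0"
  shows "coef w (g vs) = 0"
proof -
  obtain k where k: "n = Suc k" using \<open>n \<ge> 1\<close> by (cases n) auto
  obtain b where b: "b \<in> hh_coboundaries A E n"
    "g = b \<oplus>\<^bsub>hh_cochain_space A E n\<^esub> \<zero>\<^bsub>hh_cochain_space A E n\<^esub>"
    using g unfolding HH_zero_def hh_class_def a_r_coset_def' by auto
  obtain h where h: "h \<in> hh_cochains A E k" "b = hh_diff A k h"
    using b(1) k by (auto simp: hh_coboundaries_def)
  have h': "h \<in> tuples A k \<rightarrow> carrier A" using h by (auto simp: hh_cochains_def)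
  have vs': "vs \<in> tuples A (Suc k)" using vs k by simp
  have ne: "vs \<noteq> []" using vs k by auto
  have cl: "h (tl vs) \<in> carrier A" "h (butlast vs) \<in> carrier A"
    using tuples_ends[OF vs'] h' by auto
  have "h (contract A i vs) = \<zero>" if "i \<in> {1..k}" for i
  proof -
    have "i \<noteq> 0" using that by simp
    then obtain j where j: "i = Suc j" by (cases i) auto
    have "contract A i vs = take j vs @ \<zero> # drop (i + 1) vs"
      using consecutive[of j] that k j by (simp add: contract_def)
    then show ?thesis
      using cochain_zero_argument[OF h(1)] contract_tuples[OF vs', of i] that
      by (metis atLeastAtMost_iff)
  qed
  then have "coef w (b vs) = 0"
    using tuples_ends[OF vs'] cl assms(6) ne
    by (simp add: h coef_hh_diff[OF h' vs'] mult)
  moreover have "b vs \<in> carrier A" using h hh_diff_closed[OF h' vs'] by simp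
  ultimately show ?thesis using b vs by (simp add: hh_cochain_space_def)
qed

end

section \<open>The cocycle of a saturated cycle\<close>

text \<open>
  The formal properties of the operators attached to the arrows \<open>arr j\<close> of a saturated cycle of
  length \<open>N\<close>, with indices unrolled to all natural numbers: \<open>L j\<close> and \<open>R j\<close> strip \<open>arr j\<close> off the
  left and the right end, \<open>\<phi> j\<close> is the coefficient of \<open>arr j\<close>, and \<open>\<epsilon> j\<close> that of its source,
  which is also the target of the previous arrow. The correction term in the rule for
  \<open>L j (x \<otimes> y)\<close> accounts for the part of \<open>x\<close> equal to \<open>arr j\<close> and the part of \<open>y\<close> that begins with
  \<open>arr (Suc j)\<close>: their product is zero, but stripping \<open>arr j\<close> first would leave the latter. The rule
  for \<open>R\<close> is stated for successors because its correction involves the preceding arrow.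
\<close>

locale cycle_calculus = coordinate_algebra A coef
  for A :: "('k::field, 'x) module" (structure) and coef :: "'w \<Rightarrow> 'x \<Rightarrow> 'k" +
  fixes E :: "'x set" and N :: nat and arr :: "nat \<Rightarrow> 'x"
    and L R :: "nat \<Rightarrow> 'x \<Rightarrow> 'x" and \<phi> \<epsilon> :: "nat \<Rightarrow> 'x \<Rightarrow> 'k"
  assumes N_pos: "N > 0" and E_subset: "E \<subseteq> carrier A"
    and periodic: "arr (j + N) = arr j" "L (j + N) = L j" "R (j + N) = R j"
      "\<phi> (j + N) = \<phi> j" "\<epsilon> (j + N) = \<epsilon> j"
    and arr_closed [simp]: "arr j \<in> carrier A"
    and L_closed [simp]: "x \<in> carrier A \<Longrightarrow> L j x \<in> carrier A"
    and R_closed [simp]: "x \<in> carrier A \<Longrightarrow> R j x \<in> carrier A"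
    and L_add: "\<lbrakk>x \<in> carrier A; y \<in> carrier A\<rbrakk> \<Longrightarrow> L j (x \<oplus> y) = L j x \<oplus> L j y"
    and R_add: "\<lbrakk>x \<in> carrier A; y \<in> carrier A\<rbrakk> \<Longrightarrow> R j (x \<oplus> y) = R j x \<oplus> R j y"
    and \<phi>_add: "\<lbrakk>x \<in> carrier A; y \<in> carrier A\<rbrakk> \<Longrightarrow> \<phi> j (x \<oplus> y) = \<phi> j x + \<phi> j y"
    and \<epsilon>_mult: "\<lbrakk>x \<in> carrier A; y \<in> carrier A\<rbrakk> \<Longrightarrow> \<epsilon> j (x \<otimes> y) = \<epsilon> j x * \<epsilon> j y"
    and \<phi>_mult: "\<lbrakk>x \<in> carrier A; y \<in> carrier A\<rbrakk> \<Longrightarrow>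
      \<phi> j (x \<otimes> y) = \<phi> j x * \<epsilon> (Suc j) y + \<epsilon> j x * \<phi> j y"
    and L_mult: "\<lbrakk>x \<in> carrier A; y \<in> carrier A\<rbrakk> \<Longrightarrow>
      L j (x \<otimes> y) \<oplus> \<phi> j x \<odot> (arr (Suc j) \<otimes> L (Suc j) y) =
      L j x \<otimes> y \<oplus> \<epsilon> j x \<odot> L j y"
    and R_mult: "\<lbrakk>x \<in> carrier A; y \<in> carrier A\<rbrakk> \<Longrightarrow>
      R (Suc j) (x \<otimes> y) \<oplus> \<phi> (Suc j) y \<odot> (R j x \<otimes> arr j) =
      x \<otimes> R (Suc j) y \<oplus> \<epsilon> (Suc (Suc j)) y \<odot> R (Suc j) x"
    and L_E: "e \<in> E \<Longrightarrow> L j e = \<zero>" and R_E: "e \<in> E \<Longrightarrow> R j e = \<zero>" and \<phi>_E: "e \<in> E \<Longrightarrow> \<phi> j e = 0"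
begin

lemma arr_periodic_twice: "arr (j + 2 * N) = arr j"
  using periodic(1)[of j] periodic(1)[of "j + N"] by (simp add: mult_2 add.assoc)

text \<open>
  The factor \<open>z \<phi>\<^sub>j(x\<^sub>1) \<phi>\<^sub>j\<^sub>+\<^sub>1(x\<^sub>2) \<cdots> L\<^sub>j\<^sub>+\<^sub>l(x\<^sub>l\<^sub>+\<^sub>1)\<close> of a summand of the cocycle. The parameter \<open>z\<close> is kept
  free so that corrections arising at the right end can be moved to the left end.
\<close>

fun chain :: "'x \<Rightarrow> nat \<Rightarrow> 'x list \<Rightarrow> 'x" where
  "chain z j [] = \<zero>"
| "chain z j [y] = z \<otimes> L j y"
| "chain z j (x # y # ys) = \<phi> j x \<odot> chain z (Suc j) (y # ys)"

lemma chain_closed [simp]: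
  "z \<in> carrier A \<Longrightarrow> set vs \<subseteq> carrier A \<Longrightarrow> chain z j vs \<in> carrier A"
  by (induction z j vs rule: chain.induct) auto

lemma chain_Cons: "ys \<noteq> [] \<Longrightarrow> chain z j (x # ys) = \<phi> j x \<odot> chain z (Suc j) ys"
  by (cases ys) auto

lemma chain_periodic: "chain z (j + N) vs = chain z j vs"
  by (induction z j vs rule: chain.induct) (simp_all add: periodic)

lemma coef_chain_add:
  "\<lbrakk>a \<in> carrier A; b \<in> carrier A; set vs \<subseteq> carrier A\<rbrakk> \<Longrightarrow>
    coef w (chain (a \<oplus> b) j vs) = coef w (chain a j vs) + coef w (chain b j vs)"
  by (induction a j vs rule: chain.induct) (auto simp: l_distr distrib_left)

lemma coef_chain_smult:
  "\<lbrakk>a \<in> carrier A; set vs \<subseteq> carrier A\<rbrakk> \<Longrightarrow>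
    coef w (chain (c \<odot> a) j vs) = c * coef w (chain a j vs)"
  by (induction a j vs rule: chain.induct) (auto simp: smult_mult)

lemma mult_chain:
  "\<lbrakk>x \<in> carrier A; z \<in> carrier A; set vs \<subseteq> carrier A\<rbrakk> \<Longrightarrow>
    x \<otimes> chain z j vs = chain (x \<otimes> z) j vs"
  by (induction z j vs rule: chain.induct) (auto simp: mult_smult m_assoc)

lemma coef_chain_arg_add:
  "\<lbrakk>z \<in> carrier A; set us \<subseteq> carrier A; set ws \<subseteq> carrier A; x \<in> carrier A; y \<in> carrier A\<rbrakk> \<Longrightarrow>
    coef w (chain z j (us @ (x \<oplus> y) # ws)) =
    coef w (chain z j (us @ x # ws)) + coef w (chain z j (us @ y # ws))"
proof (induction us arbitrary: j)
  case Nil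
  then show ?case
    by (cases ws) (simp_all add: L_add r_distr \<phi>_add distrib_right)
next
  case (Cons u us)
  then show ?case by (simp add: chain_Cons distrib_left)
qed

lemma sum_shift_first:
  fixes g :: "nat \<Rightarrow> 'k"
  shows "(\<Sum>i=1..Suc k. g i) = g 1 + (\<Sum>i=1..k. g (Suc i))"
  by (induction k) (simp_all add: add.assoc)

text \<open>
  By the rule for \<open>\<phi>\<close>, every inner contraction contributes two terms with a factor \<open>\<epsilon>\<close>, and each
  of them appears with opposite signs in two neighbouring contractions. What survives is the
  \<open>\<epsilon>\<close>-term of the first contraction, the right end of the differential, and the correction term of
  the rule for \<open>L\<close>. As scalars commute with everything, the arrow in that correction can be moved
  next to \<open>z\<close>.
\<close>

lemma chain_telescope:
  assumes "z \<in> carrier A" "set vs \<subseteq> carrier A" "length vs = Suc l" "l \<ge> 1"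
  shows "(\<Sum>i=1..l. (- 1) ^ i * coef w (chain z j (contract A i vs))) =
    (- 1) ^ l * (coef w (chain z j (butlast vs) \<otimes> last vs)
      - coef w (chain (z \<otimes> arr (j + l)) j vs)) - \<epsilon> j (hd vs) * coef w (chain z j (tl vs))"
  using assms
proof (induction l arbitrary: vs j)
  case 0
  then show ?case by simp
next
  case (Suc l)
  obtain x y ws where vs: "vs = x # y # ws"
    using Suc.prems by (metis length_Suc_conv)
  have in_A: "x \<in> carrier A" "y \<in> carrier A" "set ws \<subseteq> carrier A" "z \<in> carrier A"
    using Suc.prems vs by auto
  show ?case
  proof (cases "l = 0")
    case True
    then have ws: "ws = []" using Suc.prems vs by simp
    have "coef w (z \<otimes> (L j (x \<otimes> y) \<oplus> \<phi> j x \<odot> (arr (Suc j) \<otimes> L (Suc j) y))) =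
        coef w (z \<otimes> (L j x \<otimes> y \<oplus> \<epsilon> j x \<odot> L j y))"
      using in_A by (simp add: L_mult)
    then show ?thesis
      using in_A by (simp add: True vs ws contract_def r_distr mult_smult m_assoc algebra_simps)
  next
    case False
    have ws: "ws \<noteq> []" using Suc.prems vs False by auto
    have IH: "(\<Sum>i=1..l. (- 1) ^ i * coef w (chain z (Suc j) (contract A i (y # ws)))) =
      (- 1) ^ l * (coef w (chain z (Suc j) (butlast (y # ws)) \<otimes> last (y # ws))
        - coef w (chain (z \<otimes> arr (Suc j + l)) (Suc j) (y # ws)))
        - \<epsilon> (Suc j) y * coef w (chain z (Suc j) ws)"
      using Suc.IH[of "y # ws" "Suc j"] in_A Suc.prems vs False by simp
    have step: "coef w (chain z j (contract A (Suc i) vs)) =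
        \<phi> j x * coef w (chain z (Suc j) (contract A i (y # ws)))" if "i \<in> {1..l}" for i
    proof -
      have "contract A i (y # ws) \<in> tuples A l"
        using that in_A Suc.prems vs by (intro contract_tuples) (auto simp: tuples_def)
      then have "set (contract A i (y # ws)) \<subseteq> carrier A" "contract A i (y # ws) \<noteq> []"
        using False by (auto simp: tuples_def)
      then show ?thesis using that in_A by (simp add: vs contract_Cons chain_Cons)
    qed
    have "(\<Sum>i=1..Suc l. (- 1) ^ i * coef w (chain z j (contract A i vs))) =
        - coef w (chain z j (contract A 1 vs)) +
        (\<Sum>i=1..l. - \<phi> j x * ((- 1) ^ i * coef w (chain z (Suc j) (contract A i (y # ws)))))"
      unfolding sum_shift_first by (intro arg_cong2[of _ _ _ _ "(+)"] sum.cong) (simp_all add: step)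
    also have "\<dots> = - coef w (chain z j (contract A 1 vs)) - \<phi> j x *
        (\<Sum>i=1..l. (- 1) ^ i * coef w (chain z (Suc j) (contract A i (y # ws))))"
      by (simp add: sum_distrib_left sum_negf)
    also have "coef w (chain z j (contract A 1 vs)) =
        (\<phi> j x * \<epsilon> (Suc j) y + \<epsilon> j x * \<phi> j y) * coef w (chain z (Suc j) ws)"
      using in_A ws by (simp add: contract_def vs chain_Cons \<phi>_mult)
    finally have expand: "(\<Sum>i=1..Suc l. (- 1) ^ i * coef w (chain z j (contract A i vs))) =
        - ((\<phi> j x * \<epsilon> (Suc j) y + \<epsilon> j x * \<phi> j y) * coef w (chain z (Suc j) ws)) - \<phi> j x *
        (\<Sum>i=1..l. (- 1) ^ i * coef w (chain z (Suc j) (contract A i (y # ws))))" .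
    have ends: "last ws \<in> carrier A" "set (butlast ws) \<subseteq> carrier A"
      using in_A ws by (auto dest: in_set_butlastD)
    show ?thesis
      unfolding expand IH using in_A ws ends
      by (simp add: vs chain_Cons smult_mult) (simp add: algebra_simps)
  qed
qed


lemma E_closed: "e \<in> E \<Longrightarrow> e \<in> carrier A"
  using E_subset by auto

lemma smult_zero [simp]: "c \<odot> \<zero> = \<zero>"
  by (rule coef_eqI) simp_all

lemma zero_smult [simp]: "x \<in> carrier A \<Longrightarrow> 0 \<odot> x = \<zero>"
  by (rule coef_eqI) simp_all

lemma \<phi>_E_mult:
  assumes "e \<in> E" "x \<in> carrier A"
  shows "\<phi> j (e \<otimes> x) = \<epsilon> j e * \<phi> j x" "\<phi> j (x \<otimes> e) = \<phi> j x * \<epsilon> (Suc j) e"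
  using assms by (simp_all add: \<phi>_mult E_closed \<phi>_E)

lemma L_E_mult:
  assumes "e \<in> E" "x \<in> carrier A"
  shows "L j (e \<otimes> x) = \<epsilon> j e \<odot> L j x" "L j (x \<otimes> e) = L j x \<otimes> e"
  using L_mult[of e x j] L_mult[of x e j] assms by (simp_all add: E_closed \<phi>_E L_E)

lemma R_E_mult:
  assumes "e \<in> E" "x \<in> carrier A"
  shows "R j (e \<otimes> x) = e \<otimes> R j x" "R j (x \<otimes> e) = \<epsilon> (Suc j) e \<odot> R j x"
proof -
  have j: "Suc (j + N - 1) = j + N" using N_pos by simp
  have \<epsilon>: "\<epsilon> (Suc (j + N)) = \<epsilon> (Suc j)" using periodic(5)[of "Suc j"] by simp
  show "R j (e \<otimes> x) = e \<otimes> R j x" "R j (x \<otimes> e) = \<epsilon> (Suc j) e \<odot> R j x"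
    using R_mult[of e x "j + N - 1"] R_mult[of x e "j + N - 1"] assms
    unfolding j \<epsilon> periodic by (simp_all add: E_closed \<phi>_E R_E)
qed

text \<open>
  In degree \<open>2 N\<close> the index of the final \<open>L\<close> is \<open>j + 2 N - 1\<close>, so that the arrow stripped off
  the last argument precedes, on the cycle, the arrow stripped off the first one.
\<close>

definition cycle_cochain :: "'x list \<Rightarrow> 'x" where
  "cycle_cochain = (\<lambda>vs\<in>tuples A (2 * N).
     finsum A (\<lambda>j. chain (R j (hd vs)) (Suc j) (tl vs)) {..<N})"

lemma tuples_double:
  assumes "x # vs \<in> tuples A (2 * N)"
  shows "x \<in> carrier A" "set vs \<subseteq> carrier A" "vs \<noteq> []"
  using assms N_pos by (auto simp: tuples_def)

lemma cycle_cochain_Cons: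
  assumes "x # vs \<in> tuples A (2 * N)"
  shows "cycle_cochain (x # vs) = finsum A (\<lambda>j. chain (R j x) (Suc j) vs) {..<N}"
  using assms by (simp add: cycle_cochain_def)

lemma
  assumes "x # vs \<in> tuples A (2 * N)"
  shows coef_cycle_cochain:
      "coef w (cycle_cochain (x # vs)) = (\<Sum>j<N. coef w (chain (R j x) (Suc j) vs))"
    and cycle_cochain_closed: "cycle_cochain (x # vs) \<in> carrier A"
proof -
  have "chain (R j x) (Suc j) vs \<in> carrier A" for j
    using tuples_double[OF assms] by simp
  then show "coef w (cycle_cochain (x # vs)) = (\<Sum>j<N. coef w (chain (R j x) (Suc j) vs))"
    "cycle_cochain (x # vs) \<in> carrier A"
    by (simp_all add: cycle_cochain_Cons[OF assms])
qed

lemma cycle_cochain_closed': "cycle_cochain \<in> tuples A (2 * N) \<rightarrow> carrier A"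
proof
  fix vs assume vs: "vs \<in> tuples A (2 * N)"
  then obtain x xs where "vs = x # xs" using N_pos by (cases vs) auto
  then show "cycle_cochain vs \<in> carrier A" using cycle_cochain_closed vs by auto
qed

text \<open>
  An element of \<open>E\<close> can be moved across a tensor sign because the scalar by which it acts at the
  target of one arrow of the cycle is the one by which it acts at the source of the next.
\<close>

lemma chain_balanced:
  "\<lbrakk>z \<in> carrier A; set us \<subseteq> carrier A; set ws \<subseteq> carrier A; x \<in> carrier A; y \<in> carrier A; e \<in> E\<rbrakk> \<Longrightarrow>
    coef w (chain z j (us @ (x \<otimes> e) # y # ws)) = coef w (chain z j (us @ x # (e \<otimes> y) # ws))"
proof (induction us arbitrary: j)
  case Nil
  then show ?case
    by (cases ws) (simp_all add: \<phi>_E_mult L_E_mult E_closed mult_smult)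
next
  case (Cons u us)
  then show ?case by (simp add: chain_Cons E_closed)
qed

lemma chain_balanced_first:
  "\<lbrakk>z \<in> carrier A; set ws \<subseteq> carrier A; y \<in> carrier A; e \<in> E\<rbrakk> \<Longrightarrow>
    coef w (chain z j ((e \<otimes> y) # ws)) = \<epsilon> j e * coef w (chain z j (y # ws))"
  by (cases ws) (simp_all add: \<phi>_E_mult L_E_mult E_closed mult_smult)

lemma chain_right_linear:
  "\<lbrakk>z \<in> carrier A; set us \<subseteq> carrier A; y \<in> carrier A; e \<in> E\<rbrakk> \<Longrightarrow>
    chain z j (us @ [y \<otimes> e]) = chain z j (us @ [y]) \<otimes> e"
proof (induction us arbitrary: j)
  case Nil
  then show ?case by (simp add: L_E_mult E_closed m_assoc)
next
  case (Cons u us)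
  then show ?case by (simp add: chain_Cons E_closed smult_mult)
qed

lemma cycle_cochain_in_cochains: "cycle_cochain \<in> hh_cochains A E (2 * N)"
proof -
  have additive: "cycle_cochain (us @ (x \<oplus> y) # ws) = cycle_cochain (us @ x # ws) \<oplus> cycle_cochain (us @ y # ws)"
    if "x \<in> carrier A" "y \<in> carrier A" and us: "us @ x # ws \<in> tuples A (2 * N)" for us ws x y
  proof -
    have t: "us @ y # ws \<in> tuples A (2 * N)" "us @ (x \<oplus> y) # ws \<in> tuples A (2 * N)"
      using that by (auto simp: tuples_def)
    have "coef w (cycle_cochain (us @ (x \<oplus> y) # ws)) =
        coef w (cycle_cochain (us @ x # ws)) + coef w (cycle_cochain (us @ y # ws))" for w
    proof (cases us)
      case Nil
      then show ?thesis using that t tuples_double[of x ws]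
        by (simp add: coef_cycle_cochain R_add coef_chain_add sum.distrib)
    next
      case (Cons u us')
      then have "set us' \<subseteq> carrier A" "set ws \<subseteq> carrier A" "u \<in> carrier A"
        using us by (auto simp: tuples_def)
      then show ?thesis using that t Cons
        by (simp add: coef_cycle_cochain coef_chain_arg_add sum.distrib)
    qed
    moreover have "cycle_cochain (us @ x # ws) \<in> carrier A" "cycle_cochain (us @ y # ws) \<in> carrier A"
      "cycle_cochain (us @ (x \<oplus> y) # ws) \<in> carrier A"
      using us t cycle_cochain_closed' by auto
    ultimately show ?thesis by (intro coef_eqI) auto
  qed
  have balanced: "cycle_cochain (us @ (x \<otimes> e) # y # ws) = cycle_cochain (us @ x # (e \<otimes> y) # ws)"
    if "e \<in> E" and us: "us @ x # y # ws \<in> tuples A (2 * N)" for us ws x y e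
  proof -
    have xy: "x \<in> carrier A" "y \<in> carrier A" "set ws \<subseteq> carrier A" "set us \<subseteq> carrier A"
      using us by (auto simp: tuples_def)
    have t: "us @ (x \<otimes> e) # y # ws \<in> tuples A (2 * N)" "us @ x # (e \<otimes> y) # ws \<in> tuples A (2 * N)"
      using that by (auto simp: tuples_def E_closed)
    have "coef w (cycle_cochain (us @ (x \<otimes> e) # y # ws)) =
        coef w (cycle_cochain (us @ x # (e \<otimes> y) # ws))" for w
    proof (cases us)
      case Nil
      then show ?thesis using that t xy
        by (simp add: coef_cycle_cochain R_E_mult coef_chain_smult chain_balanced_first)
    next
      case (Cons u us')
      then show ?thesis using that t xy
        by (simp add: coef_cycle_cochain chain_balanced)
    qed
    moreover have "cycle_cochain (us @ (x \<otimes> e) # y # ws) \<in> carrier A"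
       "cycle_cochain (us @ x # (e \<otimes> y) # ws) \<in> carrier A"
      using t cycle_cochain_closed' by auto
    ultimately show ?thesis by (intro coef_eqI) auto
  qed
  have left: "cycle_cochain ((e \<otimes> x) # ws) = e \<otimes> cycle_cochain (x # ws)"
    if "e \<in> E" and t: "x # ws \<in> tuples A (2 * N)" for x ws e
  proof -
    have t': "(e \<otimes> x) # ws \<in> tuples A (2 * N)"
      using that by (auto simp: tuples_def E_closed)
    show ?thesis using tuples_double[OF t] that(1)
      by (simp add: cycle_cochain_Cons[OF t] cycle_cochain_Cons[OF t'] finsum_rdistr Pi_iff
          R_E_mult E_closed mult_chain)
  qed
  have right: "cycle_cochain (us @ [x \<otimes> e]) = cycle_cochain (us @ [x]) \<otimes> e"
    if "e \<in> E" and t: "us @ [x] \<in> tuples A (2 * N)" for x us e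
  proof -
    obtain u us' where us: "us = u # us'"
      using t N_pos by (cases us) (auto simp: tuples_def)
    have t1: "u # (us' @ [x]) \<in> tuples A (2 * N)" using t us by simp
    have t2: "u # (us' @ [x \<otimes> e]) \<in> tuples A (2 * N)"
      using t us that(1) by (auto simp: tuples_def E_closed)
    have "set us' \<subseteq> carrier A" "x \<in> carrier A" "u \<in> carrier A"
      using t us by (auto simp: tuples_def)
    then show ?thesis using that(1) unfolding us append_Cons
      by (simp add: cycle_cochain_Cons[OF t1] cycle_cochain_Cons[OF t2] finsum_ldistr Pi_iff
          chain_right_linear E_closed)
  qed
  have "cycle_cochain \<in> tuples A (2 * N) \<rightarrow>\<^sub>E carrier A"
    using cycle_cochain_closed' by (auto simp: cycle_cochain_def PiE_def)
  then show ?thesis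
    unfolding hh_cochains_def using additive balanced left right N_pos by auto
qed

lemma sum_cyclic_shift:
  fixes g :: "nat \<Rightarrow> 'k"
  assumes "g N = g 0"
  shows "(\<Sum>j<N. g (Suc j)) = (\<Sum>j<N. g j)"
  using sum.lessThan_Suc_shift[of g N] sum.lessThan_Suc[of g N] assms
  by (simp add: add.commute)

text \<open>
  The first contraction is expanded by the rule for \<open>R\<close> and the others by \<open>chain_telescope\<close>. The
  \<open>\<epsilon>\<close>-terms cancel after a cyclic shift of the summation index. Two families of correction terms
  remain, and both have the form \<open>R\<^sub>j(x) c\<^sub>j \<phi>\<^sub>j\<^sub>+\<^sub>1(y) \<cdots>\<close>: in the one from the right end
  the arrow is \<open>c\<^sub>j\<^sub>+\<^sub>2\<^sub>N = c\<^sub>j\<close>. Their signs are opposite because the degree is even.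
\<close>

lemma cycle_cochain_cocycle: "cycle_cochain \<in> hh_cocycles A E (2 * N)"
proof (rule hh_cocyclesI[OF cycle_cochain_in_cochains])
  fix vs w assume vs_in: "vs \<in> tuples A (Suc (2 * N))"
  define n where "n = 2 * N"
  have n2: "n \<ge> 2" using N_pos by (simp add: n_def)
  obtain x y ws where vs: "vs = x # y # ws"
    using vs_in n2 by (cases vs; cases "tl vs") (auto simp: tuples_def n_def)
  have in_A: "x \<in> carrier A" "y \<in> carrier A" "set ws \<subseteq> carrier A"
    using vs_in by (auto simp: vs tuples_def)
  have "length vs = Suc n" using vs_in by (simp add: tuples_def n_def)
  then have "length ws = n - 1" by (simp add: vs)
  then have len: "length (y # ws) = Suc (n - 1)" "n - 1 \<ge> 1" and ws: "ws \<noteq> []"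
    using n2 by auto
  have in_tuples: "y # ws \<in> tuples A n" "(x \<otimes> y) # ws \<in> tuples A n" "x # butlast (y # ws) \<in> tuples A n"
    using vs_in in_A by (auto simp: n_def vs tuples_def dest: in_set_butlastD)
  have n_Suc: "n = Suc (n - 1)" using len by simp
  let ?c = "\<lambda>z j vs. coef w (chain z j vs)"
  note coefs = coef_cycle_cochain[folded n_def]
  have first: "coef w (x \<otimes> cycle_cochain (y # ws)) = (\<Sum>j<N. ?c (x \<otimes> R j y) (Suc j) ws)"
  proof -
    have "x \<otimes> cycle_cochain (y # ws) = finsum A (\<lambda>j. x \<otimes> chain (R j y) (Suc j) ws) {..<N}"
      using in_A by (simp add: cycle_cochain_Cons[folded n_def] in_tuples finsum_rdistr Pi_iff)
    then show ?thesis using in_A by (simp add: mult_chain)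
  qed
  have final: "coef w (cycle_cochain (butlast vs) \<otimes> last vs) =
      (\<Sum>j<N. coef w (chain (R j x) (Suc j) (butlast (y # ws)) \<otimes> last (y # ws)))"
  proof -
    have "last ws \<in> carrier A" "set (butlast ws) \<subseteq> carrier A"
      using in_A ws by (auto dest: in_set_butlastD)
    moreover have "butlast vs = x # butlast (y # ws)" "last vs = last ws" using ws by (simp_all add: vs)
    ultimately show ?thesis
      using in_A ws in_tuples
      by (simp add: cycle_cochain_Cons[folded n_def] finsum_ldistr Pi_iff)
  qed
  \<comment> \<open>The rule for \<open>R\<close> is available at successors only: all sums are shifted by one and back.\<close>
  have one: "coef w (cycle_cochain (contract A 1 vs)) =
      (\<Sum>j<N. ?c (x \<otimes> R j y) (Suc j) ws) + (\<Sum>j<N. \<epsilon> (Suc j) y * ?c (R j x) (Suc j) ws)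
      - (\<Sum>j<N. ?c (R j x \<otimes> arr j) (Suc j) (y # ws))"
  proof -
    have "?c (R (Suc j) (x \<otimes> y)) (Suc (Suc j)) ws =
        ?c (x \<otimes> R (Suc j) y) (Suc (Suc j)) ws
        + \<epsilon> (Suc (Suc j)) y * ?c (R (Suc j) x) (Suc (Suc j)) ws
        - ?c (R j x \<otimes> arr j) (Suc j) (y # ws)" for j
    proof -
      have "?c (R (Suc j) (x \<otimes> y) \<oplus> \<phi> (Suc j) y \<odot> (R j x \<otimes> arr j)) (Suc (Suc j)) ws =
          ?c (x \<otimes> R (Suc j) y \<oplus> \<epsilon> (Suc (Suc j)) y \<odot> R (Suc j) x) (Suc (Suc j)) ws"
        using in_A by (simp add: R_mult)
      then show ?thesis using in_A ws
        by (simp add: coef_chain_add coef_chain_smult chain_Cons algebra_simps)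
    qed
    then have "(\<Sum>j<N. ?c (R (Suc j) (x \<otimes> y)) (Suc (Suc j)) ws) =
        (\<Sum>j<N. ?c (x \<otimes> R (Suc j) y) (Suc (Suc j)) ws)
        + (\<Sum>j<N. \<epsilon> (Suc (Suc j)) y * ?c (R (Suc j) x) (Suc (Suc j)) ws)
        - (\<Sum>j<N. ?c (R j x \<otimes> arr j) (Suc j) (y # ws))"
      by (simp add: sum.distrib sum_subtractf)
    moreover have wrap: "R N = R 0" "chain z (Suc N) vs = chain z (Suc 0) vs"
        "\<epsilon> (Suc N) = \<epsilon> (Suc 0)" for z vs
      using periodic(3)[of 0] chain_periodic[of z "Suc 0" vs] periodic(5)[of "Suc 0"] by simp_all
    moreover have "contract A 1 vs = (x \<otimes> y) # ws" by (simp add: contract_def vs)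
    ultimately show ?thesis
      using sum_cyclic_shift[of "\<lambda>j. ?c (R j (x \<otimes> y)) (Suc j) ws"]
        sum_cyclic_shift[of "\<lambda>j. ?c (x \<otimes> R j y) (Suc j) ws"]
        sum_cyclic_shift[of "\<lambda>j. \<epsilon> (Suc j) y * ?c (R j x) (Suc j) ws"]
        in_tuples by (simp add: coefs)
  qed
  have others: "(\<Sum>i=1..n-1. (- 1) ^ i * coef w (cycle_cochain (contract A (Suc i) vs))) =
    (\<Sum>j<N. (- 1) ^ (n-1) * (coef w (chain (R j x) (Suc j) (butlast (y # ws)) \<otimes> last (y # ws))
      - ?c (R j x \<otimes> arr j) (Suc j) (y # ws)) - \<epsilon> (Suc j) y * ?c (R j x) (Suc j) ws)"
  proof -
    have wrap: "arr (Suc j + (n-1)) = arr j" for j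
    proof -
      have "Suc j + (n-1) = j + 2 * N" using n2 by (simp add: n_def)
      then show ?thesis using arr_periodic_twice[of j] by (simp only:)
    qed
    have "coef w (cycle_cochain (contract A (Suc i) vs)) =
        (\<Sum>j<N. ?c (R j x) (Suc j) (contract A i (y # ws)))" if "i \<in> {1..n-1}" for i
    proof -
      have "x # contract A i (y # ws) \<in> tuples A n"
        using contract_tuples[of vs n "Suc i"] vs_in that n_Suc by (simp add: contract_Cons vs n_def)
      then show ?thesis using that by (simp add: contract_Cons vs coefs)
    qed
    then have "(\<Sum>i=1..n-1. (- 1) ^ i * coef w (cycle_cochain (contract A (Suc i) vs))) =
        (\<Sum>i=1..n-1. \<Sum>j<N. (- 1) ^ i * ?c (R j x) (Suc j) (contract A i (y # ws)))"
      by (simp add: sum_distrib_left)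
    also have "\<dots> = (\<Sum>j<N. \<Sum>i=1..n-1. (- 1) ^ i * ?c (R j x) (Suc j) (contract A i (y # ws)))"
      by (rule sum.swap)
    also have "\<dots> = (\<Sum>j<N. (- 1) ^ (n-1) *
        (coef w (chain (R j x) (Suc j) (butlast (y # ws)) \<otimes> last (y # ws))
        - ?c (R j x \<otimes> arr (Suc j + (n-1))) (Suc j) (y # ws))
        - \<epsilon> (Suc j) (hd (y # ws)) * ?c (R j x) (Suc j) (tl (y # ws)))"
      using in_A len by (intro sum.cong chain_telescope refl) auto
    also have "\<dots> = (\<Sum>j<N. (- 1) ^ (n-1) *
        (coef w (chain (R j x) (Suc j) (butlast (y # ws)) \<otimes> last (y # ws))
        - ?c (R j x \<otimes> arr j) (Suc j) (y # ws)) - \<epsilon> (Suc j) y * ?c (R j x) (Suc j) ws)"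
      by (simp only: wrap list.sel)
    finally show ?thesis .
  qed
  have even: "(- 1 :: 'k) ^ (n - 1) = - 1" "(- 1 :: 'k) ^ n = 1"
    using N_pos by (simp_all add: n_def uminus_power_if)
  have split: "(\<Sum>i=1..n. (- 1) ^ i * coef w (cycle_cochain (contract A i vs))) =
      - coef w (cycle_cochain (contract A 1 vs)) -
      (\<Sum>i=1..n-1. (- 1) ^ i * coef w (cycle_cochain (contract A (Suc i) vs)))"
    by (subst n_Suc, subst sum_shift_first) (simp add: sum_negf)
  show "coef w (hd vs \<otimes> cycle_cochain (tl vs)) +
      (\<Sum>i=1..2*N. (- 1) ^ i * coef w (cycle_cochain (contract A i vs))) +
      (- 1) ^ (2*N + 1) * coef w (cycle_cochain (butlast vs) \<otimes> last vs) = 0"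
    unfolding n_def[symmetric] split one others final power_add even
    by (simp add: vs first sum.distrib sum_subtractf sum_negf)
qed

end

section \<open>Non-vanishing of the cup product and of the bracket\<close>

text \<open>
  What the calculus has to satisfy in addition for its cocycle to be seen on the cycle: \<open>base\<close> is
  the coordinate of the vertex where the cycle starts, and \<open>der\<close> is a derivation, trivial on \<open>E\<close>,
  for which the arrows have weight one.
\<close>

locale graded_cycle_calculus = cycle_calculus A coef E N arr L R \<phi> \<epsilon>
  for A :: "('k::field, 'x) module" (structure) and coef :: "'w \<Rightarrow> 'x \<Rightarrow> 'k"
    and E N arr L R \<phi> \<epsilon> +
  fixes base :: 'w and der :: "'x \<Rightarrow> 'x"
  assumes \<epsilon>_base: "\<epsilon> 0 = coef base"
    and arr_arr: "arr j \<otimes> arr (Suc j) = \<zero>"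
    and base_arr: "coef base (arr j) = 0"
    and \<phi>_arr: "\<phi> j (arr j) = 1"
    and R_arr_other: "\<lbrakk>0 < j; j < N\<rbrakk> \<Longrightarrow> R j (arr 0) = \<zero>"
    and R_arr: "coef base (R 0 (arr 0)) = 1"
    and L_arr: "coef base (L (N - 1) (arr (N - 1))) = 1"
    and der_closed [simp]: "x \<in> carrier A \<Longrightarrow> der x \<in> carrier A"
    and der_add: "\<lbrakk>x \<in> carrier A; y \<in> carrier A\<rbrakk> \<Longrightarrow> der (x \<oplus> y) = der x \<oplus> der y"
    and der_mult: "\<lbrakk>x \<in> carrier A; y \<in> carrier A\<rbrakk> \<Longrightarrow> der (x \<otimes> y) = x \<otimes> der y \<oplus> der x \<otimes> y"
    and der_E: "e \<in> E \<Longrightarrow> der e = \<zero>"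
    and der_arr: "der (arr j) = arr j"
    and base_der: "x \<in> carrier A \<Longrightarrow> coef base (der x) = 0"
begin

lemma base_mult:
  "\<lbrakk>x \<in> carrier A; y \<in> carrier A\<rbrakk> \<Longrightarrow> coef base (x \<otimes> y) = coef base x * coef base y"
  using \<epsilon>_mult[of x y 0] by (simp add: \<epsilon>_base)

abbreviation walk :: "nat \<Rightarrow> 'x list" where
  "walk n \<equiv> map arr [0..<n]"

lemma walk_tuples [simp]: "walk n \<in> tuples A n"
  by (auto simp: tuples_def)

text \<open>
  Along the cycle all the coefficients \<open>\<phi>\<close> in the chain are \<open>1\<close>. The list is written with end
  \<open>Suc (j + l)\<close> because a chain has at least one argument.
\<close>

lemma coef_chain_walk:
  assumes "z \<in> carrier A"
  shows "coef w (chain z j (map arr [j..<Suc (j + l)])) = coef w (z \<otimes> L (j + l) (arr (j + l)))"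
proof (induction l arbitrary: j)
  case (Suc l)
  have "[j..<Suc (j + Suc l)] = j # [Suc j..<Suc (Suc j + l)]"
    by (simp add: upt_conv_Cons)
  moreover have "[Suc j..<Suc (Suc j + l)] \<noteq> []" by simp
  ultimately have "chain z j (map arr [j..<Suc (j + Suc l)]) =
      \<phi> j (arr j) \<odot> chain z (Suc j) (map arr [Suc j..<Suc (Suc j + l)])"
    by (simp add: chain_Cons del: upt_Suc)
  moreover have "chain z (Suc j) (map arr [Suc j..<Suc (Suc j + l)]) \<in> carrier A"
    using assms by (intro chain_closed) auto
  ultimately show ?case using Suc[of "Suc j"] by (simp add: \<phi>_arr del: upt_Suc)
qed simp

lemma coef_chain_zero: "set vs \<subseteq> carrier A \<Longrightarrow> coef w (chain \<zero> j vs) = 0"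
  using coef_chain_smult[of \<zero> vs w 0 j] by simp

text \<open>
  Only the summand \<open>j = 0\<close> survives, since the first argument is \<open>arr 0\<close>; it is the product of
  what remains of \<open>arr 0\<close> and of \<open>arr (2 N - 1)\<close> after stripping, both of which are the base vertex.
\<close>

lemma base_cycle_cochain_walk: "coef base (cycle_cochain (walk (2 * N))) = 1"
proof -
  let ?vs = "map arr [1..<Suc (1 + (2 * N - 2))]"
  have len: "Suc (1 + (2 * N - 2)) = 2 * N" using N_pos by simp
  have walk: "walk (2 * N) = arr 0 # ?vs"
    unfolding len using N_pos by (simp add: upt_conv_Cons)
  have "coef base (cycle_cochain (walk (2 * N))) = (\<Sum>j<N. coef base (chain (R j (arr 0)) (Suc j) ?vs))"
    using walk_tuples[of "2 * N"] unfolding walk by (rule coef_cycle_cochain)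
  also have "\<dots> = (\<Sum>j<N. if j = 0 then coef base (chain (R 0 (arr 0)) 1 ?vs) else 0)"
  proof (intro sum.cong refl)
    fix j assume "j \<in> {..<N}"
    moreover have "set ?vs \<subseteq> carrier A" by auto
    ultimately show "coef base (chain (R j (arr 0)) (Suc j) ?vs) =
        (if j = 0 then coef base (chain (R 0 (arr 0)) 1 ?vs) else 0)"
      by (simp add: R_arr_other coef_chain_zero del: upt_Suc)
  qed
  also have "\<dots> = coef base (chain (R 0 (arr 0)) 1 ?vs)"
    using N_pos by simp
  also have "\<dots> = coef base (R 0 (arr 0) \<otimes> L (1 + (2 * N - 2)) (arr (1 + (2 * N - 2))))"
    by (rule coef_chain_walk) simp
  also have "1 + (2 * N - 2) = (N - 1) + N" using N_pos by simp
  also have "coef base (R 0 (arr 0) \<otimes> L ((N - 1) + N) (arr ((N - 1) + N))) = 1"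
    unfolding periodic by (simp add: base_mult R_arr L_arr del: One_nat_def)
  finally show ?thesis .
qed

lemma base_HH_zero_walk:
  assumes "g \<in> HH_zero A E n" "n \<ge> 1"
  shows "coef base (g (walk n)) = 0"
proof (rule HH_zero_augmentation[OF assms])
  show "walk n ! i \<otimes> walk n ! Suc i = \<zero>" if "Suc i < n" for i
    using that by (simp add: arr_arr)
qed (auto simp: base_mult base_arr)

theorem cycle_cup_square_nontrivial: "cup_nontrivial A E"
proof -
  let ?f = cycle_cochain and ?n = "2 * N"
  define X where "X = hh_class A E ?n ?f"
  have n: "?n \<ge> 1" "?n + ?n \<ge> 1" using N_pos by simp_all
  have X: "X \<in> HH A E ?n"
    unfolding X_def HH_def using cycle_cochain_cocycle by blast
  have "?f \<in> tuples A ?n \<rightarrow>\<^sub>E carrier A"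
    using cycle_cochain_in_cochains by (rule cochain_map)
  then have f_in: "?f \<in> X"
    unfolding X_def by (rule self_in_hh_class[OF E_subset n(1)])
  have "cup A ?n ?n ?f ?f vs \<in> carrier A" if "vs \<in> tuples A (?n + ?n)" for vs
  proof -
    have "take ?n vs \<in> tuples A ?n" "drop ?n vs \<in> tuples A ?n"
      using that by (auto simp: tuples_def dest: in_set_takeD in_set_dropD)
    then show ?thesis using that cycle_cochain_closed' by (auto simp: cup_def)
  qed
  then have "cup A ?n ?n ?f ?f \<in> tuples A (?n + ?n) \<rightarrow>\<^sub>E carrier A"
    by (auto simp: cup_def PiE_def)
  then have "cup A ?n ?n ?f ?f \<in> hh_class A E (?n + ?n) (cup A ?n ?n ?f ?f)"
    by (rule self_in_hh_class[OF E_subset n(2)])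
  then have cup_in: "cup A ?n ?n ?f ?f \<in> HH_cup A E ?n ?n X X"
    unfolding HH_cup_def using f_in by blast
  have halves: "take ?n (walk (?n + ?n)) = walk ?n" "drop ?n (walk (?n + ?n)) = walk ?n"
    using arr_periodic_twice
    by (auto simp: take_map drop_map intro!: nth_equalityI simp: add.commute)
  have "coef base (cup A ?n ?n ?f ?f (walk (?n + ?n))) = 1"
    using cycle_cochain_closed' walk_tuples[of ?n]
    by (simp only: cup_def halves walk_tuples restrict_apply if_True)
      (simp add: base_mult Pi_iff base_cycle_cochain_walk)
  then have "cup A ?n ?n ?f ?f \<notin> HH_zero A E (?n + ?n)"
    using base_HH_zero_walk[OF _ n(2)] by force
  with cup_in have "HH_cup A E ?n ?n X X \<noteq> HH_zero A E (?n + ?n)" by blast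
  then show ?thesis
    unfolding cup_nontrivial_def using X n by blast
qed

definition der_cochain :: "'x list \<Rightarrow> 'x" where
  "der_cochain = (\<lambda>vs\<in>tuples A 1. der (hd vs))"

lemma der_cochain_single [simp]: "x \<in> carrier A \<Longrightarrow> der_cochain [x] = der x"
  by (simp add: der_cochain_def)

lemma der_cochain_in_cochains: "der_cochain \<in> hh_cochains A E 1"
proof -
  have "der_cochain \<in> tuples A 1 \<rightarrow>\<^sub>E carrier A"
  proof (rule PiE_I)
    fix vs assume vs: "vs \<in> tuples A 1"
    then show "der_cochain vs \<in> carrier A" by (cases vs) (auto simp: der_cochain_def tuples_def)
  qed (simp add: der_cochain_def)
  moreover have [simp]: "us @ x # ws \<in> tuples A 1 \<longleftrightarrow> x \<in> carrier A \<and> us = [] \<and> ws = []" for us ws x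
    by (auto simp: tuples_def)
  moreover have [simp]: "x # ws \<in> tuples A 1 \<longleftrightarrow> x \<in> carrier A \<and> ws = []" for ws x
    by (auto simp: tuples_def)
  ultimately show ?thesis
    unfolding hh_cochains_def
    by (simp add: der_add der_mult der_E E_closed del: One_nat_def)
qed

lemma der_cochain_cocycle: "der_cochain \<in> hh_cocycles A E 1"
proof (rule hh_cocyclesI[OF der_cochain_in_cochains])
  fix vs w assume "vs \<in> tuples A (Suc 1)"
  then obtain x y where "vs = [x, y]" "x \<in> carrier A" "y \<in> carrier A"
    by (cases vs; cases "tl vs") (auto simp: tuples_def)
  then show "coef w (hd vs \<otimes> der_cochain (tl vs)) +
      (\<Sum>i=1..1. (- 1) ^ i * coef w (der_cochain (contract A i vs))) +
      (- 1) ^ (1 + 1) * coef w (der_cochain (butlast vs) \<otimes> last vs) = 0"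
    by (simp add: contract_def der_mult)
qed

lemma
  assumes vs: "vs \<in> tuples A (2 * N)"
  shows bracket_der_cycle_closed: "gerst_bracket A 1 (2 * N) der_cochain cycle_cochain vs \<in> carrier A"
    and coef_bracket_der_cycle: "coef w (gerst_bracket A 1 (2 * N) der_cochain cycle_cochain vs) =
      coef w (der (cycle_cochain vs)) -
      (\<Sum>i=1..2*N. coef w (cycle_cochain (take (i - 1) vs @ der (vs ! (i - 1)) # drop i vs)))"
proof -
  have f: "cycle_cochain vs \<in> carrier A" using vs cycle_cochain_closed' by auto
  have len: "length vs = 2 * N" "set vs \<subseteq> carrier A" using vs by (auto simp: tuples_def)
  have left: "circ A 1 (2 * N) der_cochain cycle_cochain vs = der (cycle_cochain vs)"
    using vs f len by (simp add: circ_def circ_at_def Pi_iff) (intro coef_eqI; simp)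
  have inner: "cycle_cochain (take (i - 1) vs @ der (vs ! (i - 1)) # drop i vs) \<in> carrier A"
    if "i \<in> {1..2*N}" for i
  proof -
    have "vs ! (i - 1) \<in> carrier A" using that len by (auto simp: subset_iff)
    then have "take (i - 1) vs @ der (vs ! (i - 1)) # drop i vs \<in> tuples A (2 * N)"
      using that len by (auto simp: tuples_def dest: in_set_takeD in_set_dropD)
    then show ?thesis using cycle_cochain_closed' by auto
  qed
  have at: "circ_at 1 i cycle_cochain der_cochain vs =
      cycle_cochain (take (i - 1) vs @ der (vs ! (i - 1)) # drop i vs)" if "i \<in> {1..2*N}" for i
  proof -
    have "take 1 (drop (i - 1) vs) = [vs ! (i - 1)]"
      using that len by (auto simp: take_Suc hd_drop_conv_nth)
    moreover have "vs ! (i - 1) \<in> carrier A" using that len by (auto simp: subset_iff)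
    ultimately show ?thesis using that by (simp add: circ_at_def)
  qed
  have right: "circ A (2 * N) 1 cycle_cochain der_cochain vs =
      finsum A (\<lambda>i. (- 1) ^ ((i + 1) * (1 + 1)) \<odot>
        cycle_cochain (take (i - 1) vs @ der (vs ! (i - 1)) # drop i vs)) {1..2*N}"
    using vs unfolding circ_def by (simp del: One_nat_def) (intro finsum_cong'; use at inner in auto)
  have right_closed: "circ A (2 * N) 1 cycle_cochain der_cochain vs \<in> carrier A"
    unfolding right using inner by (intro finsum_closed) auto
  have "coef w (circ A (2 * N) 1 cycle_cochain der_cochain vs) =
      (\<Sum>i=1..2*N. coef w (cycle_cochain (take (i - 1) vs @ der (vs ! (i - 1)) # drop i vs)))"
    unfolding right by (subst coef_finsum) (use inner in \<open>auto intro!: sum.cong\<close>)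
  then show "coef w (gerst_bracket A 1 (2 * N) der_cochain cycle_cochain vs) =
      coef w (der (cycle_cochain vs)) -
      (\<Sum>i=1..2*N. coef w (cycle_cochain (take (i - 1) vs @ der (vs ! (i - 1)) # drop i vs)))"
    using vs f left right_closed by (simp add: gerst_bracket_def)
  show "gerst_bracket A 1 (2 * N) der_cochain cycle_cochain vs \<in> carrier A"
    using vs f left right_closed by (simp add: gerst_bracket_def)
qed

text \<open>
  Replacing one arrow of the walk by its derivative changes nothing, so that the sum in
  \<open>coef_bracket_der_cycle\<close> counts the \<open>2 N\<close> arguments, while \<open>der\<close> of the value has no component
  at the base vertex.
\<close>

theorem derivation_cycle_bracket_nontrivial:
  assumes "CHAR('k) = 0"
  shows "bracket_nontrivial A E"
proof -
  let ?f = cycle_cochain and ?D = der_cochain and ?n = "2 * N"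
  let ?b = "gerst_bracket A 1 ?n ?D ?f"
  define X where "X = hh_class A E ?n ?f"
  define Y where "Y = hh_class A E 1 ?D"
  have n: "?n \<ge> 1" "1 + ?n - 1 = ?n" using N_pos by simp_all
  have XY: "X \<in> HH A E ?n" "Y \<in> HH A E 1"
    unfolding X_def Y_def HH_def using cycle_cochain_cocycle der_cochain_cocycle by blast+
  have f_in: "?f \<in> X" "?D \<in> Y"
    unfolding X_def Y_def
    using cochain_map[OF cycle_cochain_in_cochains] cochain_map[OF der_cochain_in_cochains] n(1)
    by (simp_all only: self_in_hh_class[OF E_subset] order_refl)
  have "?b \<in> tuples A ?n \<rightarrow>\<^sub>E carrier A"
    using bracket_der_cycle_closed by (auto simp: gerst_bracket_def PiE_def)
  then have "?b \<in> hh_class A E ?n ?b"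
    by (rule self_in_hh_class[OF E_subset n(1)])
  then have b_in: "?b \<in> HH_bracket A E 1 ?n Y X"
    unfolding HH_bracket_def n(2) using f_in by blast
  have "take (i - 1) (walk ?n) @ der (walk ?n ! (i - 1)) # drop i (walk ?n) = walk ?n"
    if "i \<in> {1..?n}" for i
  proof -
    have "der (walk ?n ! (i - 1)) = walk ?n ! (i - 1)" "i - 1 < length (walk ?n)" "Suc (i - 1) = i"
      using that by (auto simp: der_arr)
    then show ?thesis using id_take_nth_drop[of "i - 1" "walk ?n"] by simp
  qed
  then have "(\<Sum>i=1..?n. coef base (?f (take (i - 1) (walk ?n) @ der (walk ?n ! (i - 1)) # drop i (walk ?n))))
      = of_nat ?n"
    by (simp add: base_cycle_cochain_walk)
  moreover have "?f (walk ?n) \<in> carrier A" using cycle_cochain_closed' by auto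
  ultimately have "coef base (?b (walk ?n)) = - of_nat ?n"
    unfolding coef_bracket_der_cycle[OF walk_tuples] by (simp add: base_der)
  moreover have "of_nat ?n \<noteq> (0 :: 'k)"
    using assms N_pos by (simp add: of_nat_eq_0_iff_char_dvd del: of_nat_mult)
  ultimately have "?b \<notin> HH_zero A E ?n"
    using base_HH_zero_walk[OF _ n(1)] by force
  with b_in have "HH_bracket A E 1 ?n Y X \<noteq> HH_zero A E (1 + ?n - 1)"
    unfolding n(2) by blast
  then show ?thesis
    unfolding bracket_nontrivial_def using XY n(1) by blast
qed

end

section \<open>Gentle ideals as monomial ideals\<close>

lemma not_successivelyE:
  assumes "\<not> successively P xs"
  obtains us a b vs where "xs = us @ a # b # vs" "\<not> P a b"
proof -
  have "\<exists>us a b vs. xs = us @ a # b # vs \<and> \<not> P a b"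
    using assms
  proof (induction P xs rule: successively.induct)
    case (3 P x y xs)
    show ?case
    proof (cases "P x y")
      case True
      then obtain us a b vs where "y # xs = us @ a # b # vs" "\<not> P a b" using 3 by auto
      then show ?thesis by (metis append_Cons)
    next
      case False
      then show ?thesis by (metis append_Nil)
    qed
  qed auto
  then show ?thesis using that by blast
qed

lemma successively_take_drop:
  assumes "successively P xs"
  shows "successively P (take i xs)" "successively P (drop i xs)"
  using assms successively_append_iff[of P "take i xs" "drop i xs"] by simp_all

lemma ring_if_same_operations:
  assumes "ring B" "carrier A = carrier B" "monoid.mult A = monoid.mult B" "monoid.one A = monoid.one B"
    "ring.zero A = ring.zero B" "ring.add A = ring.add B"
  shows "ring A"
proof -
  interpret B: ring B by fact
  show ?thesis
  proof (intro ringI abelian_groupI monoidI)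
    show "\<exists>y\<in>carrier A. y \<oplus>\<^bsub>A\<^esub> x = \<zero>\<^bsub>A\<^esub>" if "x \<in> carrier A" for x
      using that B.l_neg[of x] B.a_inv_closed[of x] unfolding assms(2-6) by blast
  qed (simp_all add: assms(2-6) B.a_ac B.m_assoc B.l_distr B.r_distr)
qed

locale gentle_algebra =
  fixes Q :: "('v, 'a) pre_digraph" and I :: "(('v, 'a) path \<Rightarrow> 'k::field) set"
  assumes gentle: "gentle_bound_quiver Q I"
begin

sublocale quiver: fin_digraph Q
  using gentle by (simp add: gentle_bound_quiver_def)

abbreviation P :: "('k, ('v, 'a) path \<Rightarrow> 'k) module" where "P \<equiv> path_algebra Q"

sublocale rels: ideal I P
  using gentle by (simp add: gentle_bound_quiver_def admissible_ideal_def)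

abbreviation src :: "'a \<Rightarrow> 'v" where "src \<equiv> tail Q"
abbreviation tgt :: "'a \<Rightarrow> 'v" where "tgt \<equiv> head Q"
abbreviation path_end :: "'v \<Rightarrow> 'a list \<Rightarrow> 'v" where "path_end \<equiv> pre_digraph.awlast Q"
abbreviation paths :: "('v, 'a) path set" where "paths \<equiv> quiver_paths Q"

abbreviation reduced :: "'a list \<Rightarrow> bool" where
  "reduced \<equiv> successively (\<lambda>a b. arrow_prod Q a b \<notin> I)"

lemma paths_Nil [simp]: "(u, []) \<in> paths \<longleftrightarrow> u \<in> verts Q"
  by (auto simp: quiver_paths_def quiver.awalk_Nil_iff)

lemma paths_Cons [simp]: "(u, a # p) \<in> paths \<longleftrightarrow> a \<in> arcs Q \<and> u = src a \<and> (tgt a, p) \<in> paths"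
  by (auto simp: quiver_paths_def quiver.awalk_Cons_iff)

lemma path_end_Cons [simp]: "path_end u (a # p) = path_end (tgt a) p"
  by (cases p) simp_all

lemma path_end_append: "path_end u (p @ q) = path_end (path_end u p) q"
  by (induction p arbitrary: u) simp_all

lemma paths_append: "(u, p @ q) \<in> paths \<longleftrightarrow> (u, p) \<in> paths \<and> (path_end u p, q) \<in> paths"
proof (induction p arbitrary: u)
  case Nil
  have "(u, q) \<in> paths \<Longrightarrow> u \<in> verts Q"
    by (cases q) (auto dest: quiver.tail_in_verts)
  then show ?case by auto
qed simp

lemma src_verts: "(u, p) \<in> paths \<Longrightarrow> u \<in> verts Q"
  using paths_append[of u "[]" p] by simp

lemma mem_carrier_P:
  "x \<in> carrier P \<longleftrightarrow> finite {w. x w \<noteq> 0} \<and> (\<forall>w. x w \<noteq> 0 \<longrightarrow> w \<in> paths)"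
  by (auto simp: path_algebra_def)

lemma add_P: "x \<oplus>\<^bsub>P\<^esub> y = (\<lambda>w. x w + y w)"
  and zero_P: "\<zero>\<^bsub>P\<^esub> = (\<lambda>w. 0)"
  and smult_P: "c \<odot>\<^bsub>P\<^esub> x = (\<lambda>w. c * x w)"
  and mult_P: "(x \<otimes>\<^bsub>P\<^esub> y) (u, p) =
    (\<Sum>i\<le>length p. x (u, take i p) * y (path_end u (take i p), drop i p))"
  by (simp_all add: path_algebra_def)

lemma a_inv_P: "x \<in> carrier P \<Longrightarrow> \<ominus>\<^bsub>P\<^esub> x = (\<lambda>w. - x w)"
proof
  fix w assume "x \<in> carrier P"
  then have "(\<ominus>\<^bsub>P\<^esub> x \<oplus>\<^bsub>P\<^esub> x) w = \<zero>\<^bsub>P\<^esub> w" by (simp add: rels.l_neg)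
  then show "(\<ominus>\<^bsub>P\<^esub> x) w = - x w" by (simp add: add_P zero_P eq_neg_iff_add_eq_0)
qed

lemma smult_closed_P [simp]: "x \<in> carrier P \<Longrightarrow> c \<odot>\<^bsub>P\<^esub> x \<in> carrier P"
  by (auto simp: mem_carrier_P smult_P elim: rev_finite_subset)

lemma path_elem_closed [simp]: "w \<in> paths \<Longrightarrow> path_elem w \<in> carrier P"
  by (auto simp: mem_carrier_P path_elem_def)

lemma path_elem_mult:
  "path_elem (u, p) \<otimes>\<^bsub>P\<^esub> path_elem (path_end u p, q) = (path_elem (u, p @ q) :: _ \<Rightarrow> 'k)"
proof
  fix w :: "('v, 'a) path"
  obtain v r where w: "w = (v, r)" by (cases w)
  have "(path_elem (u, p) \<otimes>\<^bsub>P\<^esub> path_elem (path_end u p, q)) (v, r) =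
      (\<Sum>i\<le>length r. if i = length p then (if v = u \<and> r = p @ q then 1 else 0) else (0::'k))"
    unfolding mult_P
  proof (intro sum.cong refl)
    fix i assume i: "i \<in> {..length r}"
    have split: "take i r = p \<and> drop i r = q \<longleftrightarrow> i = length p \<and> r = p @ q"
      using i append_take_drop_id[of i r] by auto
    show "path_elem (u, p) (v, take i r) * path_elem (path_end u p, q) (path_end v (take i r), drop i r)
      = (if i = length p then if v = u \<and> r = p @ q then 1 else 0 else (0::'k))"
    proof (cases "v = u \<and> i = length p \<and> r = p @ q")
      case False
      then have "path_elem (u, p) (v, take i r) *
          path_elem (path_end u p, q) (path_end v (take i r), drop i r) = (0::'k)"
        using split by (simp add: path_elem_def) blast
      then show ?thesis using False by auto
    qed (simp add: path_elem_def)
  qed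
  also have "\<dots> = path_elem (u, p @ q) (v, r)"
    by (simp add: path_elem_def)
  finally show "(path_elem (u, p) \<otimes>\<^bsub>P\<^esub> path_elem (path_end u p, q)) w = (path_elem (u, p @ q) w :: 'k)"
    by (simp add: w)
qed

lemma smult_I: 
  assumes "x \<in> I"
  shows "c \<odot>\<^bsub>P\<^esub> x \<in> I"
proof -
  have x: "x \<in> carrier P" using assms by (rule rels.Icarr)
  have "(c \<odot>\<^bsub>P\<^esub> \<one>\<^bsub>P\<^esub>) \<otimes>\<^bsub>P\<^esub> x = c \<odot>\<^bsub>P\<^esub> x"
  proof
    fix w :: "('v, 'a) path"
    obtain u p where w: "w = (u, p)" by (cases w)
    have "((c \<odot>\<^bsub>P\<^esub> \<one>\<^bsub>P\<^esub>) \<otimes>\<^bsub>P\<^esub> x) (u, p) = (\<Sum>i\<le>length p. if i = 0 then c * x (u, p) else 0)"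
      unfolding mult_P
    proof (intro sum.cong refl)
      fix i assume i: "i \<in> {..length p}"
      have "x (u, p) = 0" if "u \<notin> verts Q"
        using that x src_verts by (auto simp: mem_carrier_P)
      then show "(c \<odot>\<^bsub>P\<^esub> \<one>\<^bsub>P\<^esub>) (u, take i p) * x (path_end u (take i p), drop i p) =
          (if i = 0 then c * x (u, p) else 0)"
        using i by (auto simp: smult_P path_algebra_def)
    qed
    then show "((c \<odot>\<^bsub>P\<^esub> \<one>\<^bsub>P\<^esub>) \<otimes>\<^bsub>P\<^esub> x) w = (c \<odot>\<^bsub>P\<^esub> x) w"
      by (simp add: w smult_P)
  qed
  then show ?thesis using rels.I_l_closed[OF assms, of "c \<odot>\<^bsub>P\<^esub> \<one>\<^bsub>P\<^esub>"] by simp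
qed

text \<open>
  The path factors through the product of two consecutive arrows that is a relation.
\<close>

lemma path_elem_in_I:
  assumes "(u, p) \<in> paths" "\<not> reduced p"
  shows "path_elem (u, p) \<in> I"
proof -
  obtain p1 a b p2 where p: "p = p1 @ a # b # p2" "arrow_prod Q a b \<in> I"
    by (rule not_successivelyE[OF assms(2)]) auto
  have *: "(u, p1) \<in> paths" "src a = path_end u p1" "src b = tgt a" "(tgt b, p2) \<in> paths"
    "(src a, [a, b]) \<in> paths"
    using assms(1) by (auto simp: p paths_append dest: src_verts)
  have "path_elem (u, p) =
      path_elem (u, p1) \<otimes>\<^bsub>P\<^esub> (path_elem (src a, [a, b]) \<otimes>\<^bsub>P\<^esub> (path_elem (tgt b, p2) :: _ \<Rightarrow> 'k))"
    using path_elem_mult[of u p1 "[a, b] @ p2"] path_elem_mult[of "src a" "[a, b]" p2] *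
    by (simp add: p)
  then show ?thesis
    using p(2) * by (simp add: arrow_prod_def rels.I_l_closed rels.I_r_closed)
qed

text \<open>
  Together with \<open>reduced_coeff_I\<close> this says that \<open>I\<close> is the span of the paths that are not reduced,
  so that the classes of the reduced paths form a basis of the quotient.
\<close>

lemma mem_I_if_not_reduced:
  assumes "x \<in> carrier P" "\<And>u p. reduced p \<Longrightarrow> x (u, p) = 0"
  shows "x \<in> I"
proof -
  have "x \<in> I" if "finite S" "{w. x w \<noteq> 0} \<subseteq> S" "x \<in> carrier P" "\<And>u p. reduced p \<Longrightarrow> x (u, p) = 0"
    for S x
    using that
  proof (induction S arbitrary: x rule: finite_induct)
    case empty
    then have "x = \<zero>\<^bsub>P\<^esub>" by (auto simp: zero_P)
    then show ?case by simp
  next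
    case (insert w S)
    let ?y = "x(w := 0)"
    have "finite {w. ?y w \<noteq> 0}"
      by (rule finite_subset[of _ "{w. x w \<noteq> 0}"]) (use insert.prems(2) in \<open>auto simp: mem_carrier_P\<close>)
    then have y_closed: "?y \<in> carrier P"
      using insert.prems(2) unfolding mem_carrier_P by simp
    have y: "?y \<in> I"
      by (rule insert.IH[OF _ y_closed]) (use insert.prems in auto)
    show ?case
    proof (cases "x w = 0")
      case True
      then show ?thesis using y by (simp add: fun_upd_idem)
    next
      case False
      then have "path_elem w \<in> I"
        using insert.prems by (cases w) (auto simp: mem_carrier_P intro!: path_elem_in_I)
      then have "?y \<oplus>\<^bsub>P\<^esub> (x w \<odot>\<^bsub>P\<^esub> path_elem w) \<in> I"
        using y by (simp add: smult_I)
      also have "?y \<oplus>\<^bsub>P\<^esub> (x w \<odot>\<^bsub>P\<^esub> path_elem w) = x"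
        by (auto simp: add_P smult_P path_elem_def)
      finally show ?thesis .
    qed
  qed
  from this[OF _ subset_refl assms] show ?thesis using assms(1) by (simp add: mem_carrier_P)
qed

text \<open>
  Subpaths of reduced paths are reduced, so the elements without reduced paths in their support
  form an ideal; it contains the generators of \<open>I\<close>, which are paths of length two.
\<close>

lemma reduced_coeff_I:
  assumes "x \<in> I" "reduced p"
  shows "x (u, p) = 0"
proof -
  obtain R where R: "R \<subseteq> {w \<in> paths. length (snd w) = 2}" "I = genideal P (path_elem ` R)"
    using gentle by (auto simp: gentle_bound_quiver_def)
  define M :: "(('v, 'a) path \<Rightarrow> 'k) set" where
    "M = {x \<in> carrier P. \<forall>u p. reduced p \<longrightarrow> x (u, p) = 0}"
  have "ideal M P"
  proof (rule idealI)
    show "ring P" by (rule rels.ring_axioms)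
    show "subgroup M (add_monoid P)"
    proof (rule rels.add.subgroupI)
      show "M \<subseteq> carrier P" by (auto simp: M_def)
      have "\<zero>\<^bsub>P\<^esub> \<in> M" by (simp add: M_def) (simp add: zero_P)
      then show "M \<noteq> {}" by auto
      show "\<ominus>\<^bsub>P\<^esub> a \<in> M" if "a \<in> M" for a
        using that rels.a_inv_closed[of a] by (auto simp: M_def a_inv_P)
      show "a \<oplus>\<^bsub>P\<^esub> b \<in> M" if "a \<in> M" "b \<in> M" for a b
        using that rels.a_closed[of a b] by (auto simp: M_def add_P)
    qed
    show "x \<otimes>\<^bsub>P\<^esub> a \<in> M" "a \<otimes>\<^bsub>P\<^esub> x \<in> M" if "a \<in> M" "x \<in> carrier P" for a x
      using that rels.m_closed[of a x] rels.m_closed[of x a]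
      by (auto simp: M_def mult_P successively_take_drop)
  qed
  moreover have "path_elem ` R \<subseteq> M"
  proof
    fix y :: "('v, 'a) path \<Rightarrow> 'k" assume "y \<in> path_elem ` R"
    then obtain v q where y: "y = path_elem (v, q)" "(v, q) \<in> R" by auto
    then have q: "(v, q) \<in> paths" "length q = 2" using R(1) by auto
    obtain a b where ab: "q = [a, b]"
      using q(2) by (auto simp: numeral_2_eq_2 length_Suc_conv)
    have "(path_elem ` R :: (('v, 'a) path \<Rightarrow> 'k) set) \<subseteq> carrier P" using R(1) by auto
    then have "y \<in> I" using rels.genideal_self[of "path_elem ` R"] y R(2) by blast
    then have y_closed: "y \<in> carrier P" by (rule rels.Icarr)
    from \<open>y \<in> I\<close> have "arrow_prod Q a b \<in> I" using y q ab by (simp add: arrow_prod_def)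
    then show "y \<in> M" using y_closed y(1) q ab by (auto simp: M_def) (auto simp: path_elem_def)
  qed
  ultimately have "I \<subseteq> M" using rels.genideal_minimal[of M "path_elem ` R"] R(2) by simp
  then show ?thesis using assms by (auto simp: M_def)
qed

section \<open>Path coefficients on the bound quiver algebra\<close>


abbreviation \<Lambda> :: "('k, (('v, 'a) path \<Rightarrow> 'k) set) module" where
  "\<Lambda> \<equiv> bound_quiver_algebra Q I"

abbreviation cls :: "(('v, 'a) path \<Rightarrow> 'k) \<Rightarrow> (('v, 'a) path \<Rightarrow> 'k) set" where
  "cls x \<equiv> I +>\<^bsub>P\<^esub> x"

text \<open>
  The coefficient at a reduced path is constant on a coset of \<open>I\<close>, so any representative serves.
  At the other paths it is set to \<open>0\<close>, which makes these the coefficients of the normal form.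
\<close>

definition path_coeff :: "('v, 'a) path \<Rightarrow> (('v, 'a) path \<Rightarrow> 'k) set \<Rightarrow> 'k" where
  "path_coeff w X = (if reduced (snd w) then (SOME x. x \<in> X) w else 0)"

lemma path_coeff_cls:
  assumes "x \<in> carrier P"
  shows "path_coeff w (cls x) = (if reduced (snd w) then x w else 0)"
proof -
  have "x \<in> cls x" using assms by (rule rels.a_rcos_self)
  then have "(SOME y. y \<in> cls x) \<in> cls x" by (rule someI[of "\<lambda>y. y \<in> cls x"])
  then obtain i where "i \<in> I" "(SOME y. y \<in> cls x) = i \<oplus>\<^bsub>P\<^esub> x"
    by (auto simp: a_r_coset_def')
  then show ?thesis using reduced_coeff_I[of i "snd w" "fst w"]
    by (simp add: path_coeff_def add_P)
qed

lemma carrier_\<Lambda>: "carrier \<Lambda> = cls ` carrier P"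
  by (auto simp: bound_quiver_algebra_def quotient_algebra_def FactRing_def A_RCOSETS_def')

lemma cls_closed [simp]: "x \<in> carrier P \<Longrightarrow> cls x \<in> carrier \<Lambda>"
  by (simp add: carrier_\<Lambda>)

lemma cls_mult: "\<lbrakk>x \<in> carrier P; y \<in> carrier P\<rbrakk> \<Longrightarrow> cls x \<otimes>\<^bsub>\<Lambda>\<^esub> cls y = cls (x \<otimes>\<^bsub>P\<^esub> y)"
  by (simp add: bound_quiver_algebra_def quotient_algebra_def FactRing_def rels.rcoset_mult_add)

lemma cls_add: "\<lbrakk>x \<in> carrier P; y \<in> carrier P\<rbrakk> \<Longrightarrow> cls x \<oplus>\<^bsub>\<Lambda>\<^esub> cls y = cls (x \<oplus>\<^bsub>P\<^esub> y)"
  by (simp add: bound_quiver_algebra_def quotient_algebra_def FactRing_def rels.a_rcos_sum)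

lemma cls_eq_iff: "\<lbrakk>x \<in> carrier P; y \<in> carrier P\<rbrakk> \<Longrightarrow> cls x = cls y \<longleftrightarrow> x \<ominus>\<^bsub>P\<^esub> y \<in> I"
  using rels.quotient_eq_iff_same_a_r_cos[OF rels.is_ideal] by blast

lemma cls_eqI:
  assumes "x \<in> carrier P" "y \<in> carrier P" "\<And>u p. reduced p \<Longrightarrow> x (u, p) = y (u, p)"
  shows "cls x = cls y"
proof -
  have "x \<ominus>\<^bsub>P\<^esub> y = (\<lambda>w. x w - y w)"
    using assms by (simp add: a_minus_def add_P a_inv_P)
  then have "x \<ominus>\<^bsub>P\<^esub> y \<in> I"
    using assms rels.minus_closed[of x y] by (intro mem_I_if_not_reduced) auto
  then show ?thesis using assms cls_eq_iff by simp
qed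

lemma cls_smult:
  assumes "x \<in> carrier P"
  shows "c \<odot>\<^bsub>\<Lambda>\<^esub> cls x = cls (c \<odot>\<^bsub>P\<^esub> x)"
proof -
  have "cls (c \<odot>\<^bsub>P\<^esub> y) = cls (c \<odot>\<^bsub>P\<^esub> x)" if "y \<in> cls x" for y
  proof -
    obtain i where i: "i \<in> I" "y = i \<oplus>\<^bsub>P\<^esub> x" using \<open>y \<in> cls x\<close> by (auto simp: a_r_coset_def')
    have "y \<in> carrier P" using i assms rels.Icarr by simp
    then show ?thesis
      by (intro cls_eqI smult_closed_P assms)
        (simp_all add: i(2) smult_P add_P reduced_coeff_I[OF i(1)])
  qed
  then have "(\<Union>y\<in>cls x. cls (c \<odot>\<^bsub>P\<^esub> y)) = (\<Union>y\<in>cls x. cls (c \<odot>\<^bsub>P\<^esub> x))"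
    by (intro SUP_cong refl)
  also have "\<dots> = cls (c \<odot>\<^bsub>P\<^esub> x)"
    using rels.a_rcos_self[OF assms] by (subst UN_constant) auto
  finally show ?thesis
    by (simp only: bound_quiver_algebra_def quotient_algebra_def module.simps)
qed

lemma ring_\<Lambda>: "ring \<Lambda>"
  by (rule ring_if_same_operations[OF rels.quotient_is_ring])
    (simp_all add: bound_quiver_algebra_def quotient_algebra_def)

lemma carrier_\<Lambda>E:
  assumes "X \<in> carrier \<Lambda>"
  obtains x where "x \<in> carrier P" "X = cls x" "\<And>w. path_coeff w X = (if reduced (snd w) then x w else 0)"
proof -
  obtain x where x: "x \<in> carrier P" "X = cls x" using assms unfolding carrier_\<Lambda> by (rule imageE)
  show thesis by (rule that[OF x]) (simp add: x path_coeff_cls)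
qed

sublocale coordinate_algebra \<Lambda> path_coeff
proof (intro coordinate_algebra.intro coordinate_algebra_axioms.intro ring_\<Lambda>)
  fix X Y c w assume X: "X \<in> carrier \<Lambda>"
  then obtain x where x: "x \<in> carrier P" "X = cls x" by (rule carrier_\<Lambda>E)
  show "c \<odot>\<^bsub>\<Lambda>\<^esub> X \<in> carrier \<Lambda>" "path_coeff w (c \<odot>\<^bsub>\<Lambda>\<^esub> X) = c * path_coeff w X"
    using x by (simp_all add: cls_smult path_coeff_cls) (simp add: smult_P)
  assume "Y \<in> carrier \<Lambda>"
  then obtain y where y: "y \<in> carrier P" "Y = cls y" by (rule carrier_\<Lambda>E)
  show "path_coeff w (X \<oplus>\<^bsub>\<Lambda>\<^esub> Y) = path_coeff w X + path_coeff w Y"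
    using x y by (simp add: cls_add path_coeff_cls) (simp add: add_P)
  show "X = Y" if "\<And>w. path_coeff w X = path_coeff w Y"
    unfolding x y
  proof (rule cls_eqI[OF x(1) y(1)])
    show "x (u, p) = y (u, p)" if "reduced p" for u p
      using \<open>\<And>w. path_coeff w X = path_coeff w Y\<close>[of "(u, p)"] that x y by (simp add: path_coeff_cls)
  qed
  have "(c \<odot>\<^bsub>P\<^esub> x) \<otimes>\<^bsub>P\<^esub> y = c \<odot>\<^bsub>P\<^esub> (x \<otimes>\<^bsub>P\<^esub> y)"
    by (rule ext, rename_tac w, case_tac w) (simp add: mult_P smult_P sum_distrib_left mult.assoc)
  moreover have "x \<otimes>\<^bsub>P\<^esub> (c \<odot>\<^bsub>P\<^esub> y) = c \<odot>\<^bsub>P\<^esub> (x \<otimes>\<^bsub>P\<^esub> y)"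
    by (rule ext, rename_tac w, case_tac w) (simp add: mult_P smult_P sum_distrib_left mult.left_commute)
  ultimately show "(c \<odot>\<^bsub>\<Lambda>\<^esub> X) \<otimes>\<^bsub>\<Lambda>\<^esub> Y = c \<odot>\<^bsub>\<Lambda>\<^esub> (X \<otimes>\<^bsub>\<Lambda>\<^esub> Y)" "X \<otimes>\<^bsub>\<Lambda>\<^esub> (c \<odot>\<^bsub>\<Lambda>\<^esub> Y) = c \<odot>\<^bsub>\<Lambda>\<^esub> (X \<otimes>\<^bsub>\<Lambda>\<^esub> Y)"
    using x y by (simp_all add: cls_smult cls_mult)
qed

lemma path_coeff_mult:
  assumes "X \<in> carrier \<Lambda>" "Y \<in> carrier \<Lambda>"
  shows "path_coeff (u, p) (X \<otimes>\<^bsub>\<Lambda>\<^esub> Y) = (if reduced p then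
    \<Sum>i\<le>length p. path_coeff (u, take i p) X * path_coeff (path_end u (take i p), drop i p) Y else 0)"
proof -
  obtain x where x: "x \<in> carrier P" "X = cls x" "\<And>w. path_coeff w X = (if reduced (snd w) then x w else 0)"
    using assms(1) by (rule carrier_\<Lambda>E) blast
  obtain y where y: "y \<in> carrier P" "Y = cls y" "\<And>w. path_coeff w Y = (if reduced (snd w) then y w else 0)"
    using assms(2) by (rule carrier_\<Lambda>E) blast
  show ?thesis
    using x(1,2) y(1,2) by (simp add: cls_mult path_coeff_cls)
      (auto simp: mult_P successively_take_drop intro!: sum.cong)
qed

lemma path_coeff_not_reduced: "\<not> reduced p \<Longrightarrow> path_coeff (u, p) X = 0"
  by (simp add: path_coeff_def)

lemma path_coeff_finite:
  assumes "X \<in> carrier \<Lambda>"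
  shows "finite {w. path_coeff w X \<noteq> 0}"
proof -
  obtain x where x: "x \<in> carrier P" "X = cls x" "\<And>w. path_coeff w X = (if reduced (snd w) then x w else 0)"
    using assms by (rule carrier_\<Lambda>E) blast
  then have "{w. path_coeff w X \<noteq> 0} \<subseteq> {w. x w \<noteq> 0}" by auto
  moreover have "finite {w. x w \<noteq> 0}" using x(1) by (simp add: mem_carrier_P)
  ultimately show ?thesis by (rule finite_subset)
qed

lemma path_coeff_path:
  assumes "X \<in> carrier \<Lambda>" "path_coeff w X \<noteq> 0"
  shows "w \<in> paths"
  using assms(1)
proof (rule carrier_\<Lambda>E)
  fix x assume "x \<in> carrier P" "\<And>w. path_coeff w X = (if reduced (snd w) then x w else 0)"
  then show ?thesis using assms(2) by (cases w) (auto simp: mem_carrier_P split: if_splits)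
qed

section \<open>Leibniz rules for stripping an arrow\<close>

definition arrow :: "'a \<Rightarrow> (('v, 'a) path \<Rightarrow> 'k) set" where
  "arrow a = cls (path_elem (src a, [a]))"

definition strip_left :: "'a \<Rightarrow> (('v, 'a) path \<Rightarrow> 'k) set \<Rightarrow> (('v, 'a) path \<Rightarrow> 'k) set" where
  "strip_left a X = cls (\<lambda>(u, p). if u = tgt a then path_coeff (src a, a # p) X else 0)"

definition strip_right :: "'a \<Rightarrow> (('v, 'a) path \<Rightarrow> 'k) set \<Rightarrow> (('v, 'a) path \<Rightarrow> 'k) set" where
  "strip_right a X = cls (\<lambda>(u, p). path_coeff (u, p @ [a]) X)"

definition euler :: "(('v, 'a) path \<Rightarrow> 'k) set \<Rightarrow> (('v, 'a) path \<Rightarrow> 'k) set" where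
  "euler X = cls (\<lambda>w. of_nat (length (snd w)) * path_coeff w X)"

lemma arrow_closed [simp]: "a \<in> arcs Q \<Longrightarrow> arrow a \<in> carrier \<Lambda>"
  by (simp add: arrow_def)

lemma path_coeff_arrow: "a \<in> arcs Q \<Longrightarrow> path_coeff w (arrow a) = (if w = (src a, [a]) then 1 else 0)"
  by (auto simp: arrow_def path_coeff_cls) (auto simp: path_elem_def)

lemma
  assumes X: "X \<in> carrier \<Lambda>"
  shows strip_left_closed [simp]: "strip_left a X \<in> carrier \<Lambda>"
    and path_coeff_strip_left: "path_coeff (u, p) (strip_left a X) = (if u = tgt a then path_coeff (src a, a # p) X else 0)"
proof -
  let ?x = "\<lambda>(u, p). if u = tgt a then path_coeff (src a, a # p) X else 0"
  have "{w. ?x w \<noteq> 0} \<subseteq> (\<lambda>(v, q). (tgt a, tl q)) ` {w. path_coeff w X \<noteq> 0}"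
  proof
    fix w assume "w \<in> {w. ?x w \<noteq> 0}"
    then show "w \<in> (\<lambda>(v, q). (tgt a, tl q)) ` {w. path_coeff w X \<noteq> 0}"
      by (cases w) (auto split: if_splits intro!: rev_image_eqI[of "(src a, a # snd w)"])
  qed
  then have "finite {w. ?x w \<noteq> 0}" using path_coeff_finite[OF X] by (meson finite_surj)
  then have "?x \<in> carrier P" using path_coeff_path[OF X, of "(src a, a # p)" for p]
    by (auto simp: mem_carrier_P split: if_splits)
  then show "strip_left a X \<in> carrier \<Lambda>"
    "path_coeff (u, p) (strip_left a X) = (if u = tgt a then path_coeff (src a, a # p) X else 0)"
    by (auto simp: strip_left_def path_coeff_cls successively_Cons intro: path_coeff_not_reduced)
qed

lemma
  assumes X: "X \<in> carrier \<Lambda>"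
  shows strip_right_closed [simp]: "strip_right a X \<in> carrier \<Lambda>"
    and path_coeff_strip_right: "path_coeff (u, p) (strip_right a X) = path_coeff (u, p @ [a]) X"
proof -
  let ?x = "\<lambda>(u, p). path_coeff (u, p @ [a]) X"
  have "{w. ?x w \<noteq> 0} \<subseteq> (\<lambda>(v, q). (v, butlast q)) ` {w. path_coeff w X \<noteq> 0}"
  proof
    fix w assume "w \<in> {w. ?x w \<noteq> 0}"
    then show "w \<in> (\<lambda>(v, q). (v, butlast q)) ` {w. path_coeff w X \<noteq> 0}"
      by (cases w) (auto intro!: rev_image_eqI[of "(fst w, snd w @ [a])"])
  qed
  then have "finite {w. ?x w \<noteq> 0}" using path_coeff_finite[OF X] by (meson finite_surj)
  then have "?x \<in> carrier P" using path_coeff_path[OF X, of "(u, p @ [a])" for u p]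
    by (auto simp: mem_carrier_P paths_append)
  then show "strip_right a X \<in> carrier \<Lambda>"
    "path_coeff (u, p) (strip_right a X) = path_coeff (u, p @ [a]) X"
    by (auto simp: strip_right_def path_coeff_cls successively_append_iff path_coeff_not_reduced)
qed

lemma
  assumes X: "X \<in> carrier \<Lambda>"
  shows euler_closed [simp]: "euler X \<in> carrier \<Lambda>"
    and path_coeff_euler: "path_coeff w (euler X) = of_nat (length (snd w)) * path_coeff w X"
proof -
  let ?x = "\<lambda>w. of_nat (length (snd w)) * path_coeff w X"
  have "{w. ?x w \<noteq> 0} \<subseteq> {w. path_coeff w X \<noteq> 0}" by auto
  then have "finite {w. ?x w \<noteq> 0}" using path_coeff_finite[OF X] by (rule finite_subset)
  then have x: "?x \<in> carrier P" using path_coeff_path[OF X]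
    by (auto simp: mem_carrier_P)
  then show "euler X \<in> carrier \<Lambda>" by (simp add: euler_def)
  show "path_coeff w (euler X) = of_nat (length (snd w)) * path_coeff w X"
    using x by (cases w) (simp add: euler_def path_coeff_cls path_coeff_not_reduced)
qed

lemma path_coeff_mult_arrow_left:
  assumes "a \<in> arcs Q" "X \<in> carrier \<Lambda>"
  shows "path_coeff (u, p) (arrow a \<otimes>\<^bsub>\<Lambda>\<^esub> X) =
    (if reduced p \<and> p \<noteq> [] \<and> u = src a \<and> hd p = a then path_coeff (tgt a, tl p) X else 0)"
proof (cases p)
  case Nil
  then show ?thesis using assms by (simp add: path_coeff_mult path_coeff_arrow)
next
  case (Cons b q)
  have "(\<Sum>i\<le>length p. path_coeff (u, take i p) (arrow a) * path_coeff (path_end u (take i p), drop i p) X) =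
      (\<Sum>i\<le>length p. if i = 1 then (if u = src a \<and> b = a then path_coeff (tgt a, q) X else 0) else 0)"
  proof (intro sum.cong refl)
    fix i assume i: "i \<in> {..length p}"
    have "take i p = [a] \<longleftrightarrow> i = 1 \<and> b = a"
    proof
      assume *: "take i p = [a]"
      have "length (take i p) = 1" unfolding * by simp
      then have "i = 1" using i by simp
      then show "i = 1 \<and> b = a" using * Cons by simp
    qed (use Cons in simp)
    then show "path_coeff (u, take i p) (arrow a) * path_coeff (path_end u (take i p), drop i p) X =
      (if i = 1 then (if u = src a \<and> b = a then path_coeff (tgt a, q) X else 0) else 0)"
      using assms Cons by (auto simp: path_coeff_arrow)
  qed
  also have "\<dots> = (if u = src a \<and> b = a then path_coeff (tgt a, q) X else 0)"
    using Cons by (subst sum.delta) auto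
  finally show ?thesis
    by (simp only: path_coeff_mult[OF arrow_closed[OF assms(1)] assms(2)]) (auto simp: Cons)
qed

lemma path_coeff_mult_arrow_right:
  assumes "a \<in> arcs Q" "X \<in> carrier \<Lambda>"
  shows "path_coeff (u, p) (X \<otimes>\<^bsub>\<Lambda>\<^esub> arrow a) =
    (if reduced p \<and> p \<noteq> [] \<and> path_end u (butlast p) = src a \<and> last p = a
     then path_coeff (u, butlast p) X else 0)"
proof (cases p rule: rev_cases)
  case Nil
  then show ?thesis using assms by (simp add: path_coeff_mult path_coeff_arrow)
next
  case (snoc q b)
  have "(\<Sum>i\<le>length p. path_coeff (u, take i p) X * path_coeff (path_end u (take i p), drop i p) (arrow a)) =
      (\<Sum>i\<le>length p. if i = length q then
        (if path_end u q = src a \<and> b = a then path_coeff (u, q) X else 0) else 0)"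
  proof (intro sum.cong refl)
    fix i assume i: "i \<in> {..length p}"
    have "drop i p = [a] \<longleftrightarrow> i = length q \<and> b = a"
    proof
      assume *: "drop i p = [a]"
      have "length p = Suc (length q)" unfolding snoc by simp
      moreover have "length p - i = 1"
        unfolding length_drop[symmetric] * by simp
      ultimately have "i = length q" by linarith
      then show "i = length q \<and> b = a" using * unfolding snoc by simp
    next
      assume "i = length q \<and> b = a"
      then show "drop i p = [a]" unfolding snoc by simp
    qed
    moreover have "take i p = q" if "i = length q" unfolding snoc that by simp
    ultimately show "path_coeff (u, take i p) X * path_coeff (path_end u (take i p), drop i p) (arrow a) =
      (if i = length q then (if path_end u q = src a \<and> b = a then path_coeff (u, q) X else 0) else 0)"
      using assms(1) by (simp add: path_coeff_arrow)
  qed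
  also have "\<dots> = (if path_end u q = src a \<and> b = a then path_coeff (u, q) X else 0)"
    using snoc by (subst sum.delta) auto
  finally show ?thesis
    by (simp only: path_coeff_mult[OF assms(2) arrow_closed[OF assms(1)]]) (auto simp: snoc)
qed


abbreviation rel :: "'a \<Rightarrow> 'a \<Rightarrow> bool" where
  "rel a b \<equiv> arrow_prod Q a b \<in> I"

lemma rel_unique:
  assumes "a \<in> arcs Q"
  shows unique_successor:
      "\<lbrakk>b \<in> arcs Q; tgt a = src b; rel a b; c \<in> arcs Q; tgt a = src c; rel a c\<rbrakk> \<Longrightarrow> b = c"
    and unique_predecessor:
      "\<lbrakk>b \<in> arcs Q; tgt b = src a; rel b a; c \<in> arcs Q; tgt c = src a; rel c a\<rbrakk> \<Longrightarrow> b = c"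
proof -
  have card: "card {b \<in> arcs Q. tgt a = src b \<and> rel a b} \<le> 1"
    "card {b \<in> arcs Q. tgt b = src a \<and> rel b a} \<le> 1"
    using gentle assms unfolding gentle_bound_quiver_def by blast+
  have "finite {b \<in> arcs Q. tgt a = src b \<and> rel a b}" "finite {b \<in> arcs Q. tgt b = src a \<and> rel b a}"
    by simp_all
  then have "\<forall>b\<in>{b \<in> arcs Q. tgt a = src b \<and> rel a b}. \<forall>c\<in>{b \<in> arcs Q. tgt a = src b \<and> rel a b}. b = c"
    "\<forall>b\<in>{b \<in> arcs Q. tgt b = src a \<and> rel b a}. \<forall>c\<in>{b \<in> arcs Q. tgt b = src a \<and> rel b a}. b = c"
    using card by (simp_all only: card_le_Suc0_iff_eq One_nat_def)
  then show "\<lbrakk>b \<in> arcs Q; tgt a = src b; rel a b; c \<in> arcs Q; tgt a = src c; rel a c\<rbrakk> \<Longrightarrow> b = c"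
    "\<lbrakk>b \<in> arcs Q; tgt b = src a; rel b a; c \<in> arcs Q; tgt c = src a; rel c a\<rbrakk> \<Longrightarrow> b = c"
    by blast+
qed

lemma coord_eqI:
  assumes "X \<in> carrier \<Lambda>" "Y \<in> carrier \<Lambda>" "\<And>u p. path_coeff (u, p) X = path_coeff (u, p) Y"
  shows "X = Y"
  using assms by (intro coef_eqI) auto

lemma vertex_coeff_mult:
  assumes "X \<in> carrier \<Lambda>" "Y \<in> carrier \<Lambda>"
  shows "path_coeff (u, []) (X \<otimes>\<^bsub>\<Lambda>\<^esub> Y) = path_coeff (u, []) X * path_coeff (u, []) Y"
  using assms by (simp add: path_coeff_mult)

lemma arrow_coeff_mult:
  assumes "X \<in> carrier \<Lambda>" "Y \<in> carrier \<Lambda>"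
  shows "path_coeff (src a, [a]) (X \<otimes>\<^bsub>\<Lambda>\<^esub> Y) =
    path_coeff (src a, [a]) X * path_coeff (tgt a, []) Y + path_coeff (src a, []) X * path_coeff (src a, [a]) Y"
  using assms by (simp add: path_coeff_mult)

text \<open>
  Compare coefficients at a path \<open>p\<close> that starts at the target of \<open>a\<close>. If \<open>a p\<close> is reduced, both
  sides are the sum over all the ways to split \<open>a p\<close>. If \<open>p\<close> is reduced but \<open>a p\<close> is not, the only
  splitting seen by \<open>L\<^sub>a(X) Y\<close> is \<open>a | p\<close>, and by gentleness the first arrow of \<open>p\<close> must
  be \<open>b\<close>: this is the correction term.
\<close>

lemma strip_left_mult:
  assumes X: "X \<in> carrier \<Lambda>" and Y: "Y \<in> carrier \<Lambda>"
    and ab: "a \<in> arcs Q" "b \<in> arcs Q" "tgt a = src b" "rel a b"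
  shows "strip_left a (X \<otimes>\<^bsub>\<Lambda>\<^esub> Y) \<oplus>\<^bsub>\<Lambda>\<^esub> path_coeff (src a, [a]) X \<odot>\<^bsub>\<Lambda>\<^esub> (arrow b \<otimes>\<^bsub>\<Lambda>\<^esub> strip_left b Y) =
    strip_left a X \<otimes>\<^bsub>\<Lambda>\<^esub> Y \<oplus>\<^bsub>\<Lambda>\<^esub> path_coeff (src a, []) X \<odot>\<^bsub>\<Lambda>\<^esub> strip_left a Y"
proof (rule coef_eqI)
  fix w :: "('v, 'a) path"
  obtain u p where w: "w = (u, p)" by (cases w)
  let ?s = "\<Sum>i\<le>length p. path_coeff (src a, a # take i p) X * path_coeff (path_end u (take i p), drop i p) Y"
  have left: "path_coeff (u, p) (strip_left a (X \<otimes>\<^bsub>\<Lambda>\<^esub> Y)) =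
      (if u = tgt a \<and> reduced (a # p)
       then path_coeff (src a, []) X * path_coeff (src a, a # p) Y + ?s else 0)"
    using X Y by (simp add: path_coeff_strip_left path_coeff_mult sum.atMost_Suc_shift del: sum.atMost_Suc)
  have correction: "path_coeff (u, p) (arrow b \<otimes>\<^bsub>\<Lambda>\<^esub> strip_left b Y) =
      (if p \<noteq> [] \<and> u = src b \<and> hd p = b then path_coeff (u, p) Y else 0)"
    using Y ab by (cases p) (auto simp: path_coeff_mult_arrow_left path_coeff_strip_left path_coeff_not_reduced)
  have right: "path_coeff (u, p) (strip_left a X \<otimes>\<^bsub>\<Lambda>\<^esub> Y) =
      (if u = tgt a \<and> reduced p then ?s else 0)"
    using X Y by (simp add: path_coeff_mult path_coeff_strip_left)
  have "path_coeff (u, p) (strip_left a (X \<otimes>\<^bsub>\<Lambda>\<^esub> Y)) +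
      path_coeff (src a, [a]) X * path_coeff (u, p) (arrow b \<otimes>\<^bsub>\<Lambda>\<^esub> strip_left b Y) =
      path_coeff (u, p) (strip_left a X \<otimes>\<^bsub>\<Lambda>\<^esub> Y) + path_coeff (src a, []) X * path_coeff (u, p) (strip_left a Y)"
  proof (cases "u = tgt a \<and> reduced p")
    case False
    then show ?thesis
      using Y ab by (auto simp: left correction right path_coeff_strip_left path_coeff_not_reduced
          successively_Cons)
  next
    case True
    show ?thesis
    proof (cases "reduced (a # p)")
      case reduced: True
      then have "\<not> (p \<noteq> [] \<and> hd p = b)" using ab(4) by (auto simp: successively_Cons)
      then show ?thesis
        unfolding left correction right using True reduced Y by (auto simp: path_coeff_strip_left)
    next
      case False
      then have p: "p \<noteq> []" "rel a (hd p)" using True by (auto simp: successively_Cons)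
      have "?s = (\<Sum>i\<le>length p. if i = 0 then path_coeff (src a, [a]) X * path_coeff (u, p) Y else 0)"
      proof (intro sum.cong refl)
        fix i
        have "\<not> reduced (a # take i p)" if "i \<noteq> 0"
          using that p by (cases i; cases p) (auto simp: successively_Cons)
        then show "path_coeff (src a, a # take i p) X * path_coeff (path_end u (take i p), drop i p) Y =
            (if i = 0 then path_coeff (src a, [a]) X * path_coeff (u, p) Y else 0)"
          by (simp add: path_coeff_not_reduced)
      qed
      then have s: "?s = path_coeff (src a, [a]) X * path_coeff (u, p) Y" by simp
      have "hd p = b" if "path_coeff (u, p) Y \<noteq> 0"
      proof -
        have "(u, p) \<in> paths" using path_coeff_path[OF Y that] .
        then have "hd p \<in> arcs Q" "src (hd p) = u" using p(1) by (cases p; simp)+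
        then show ?thesis
          using unique_successor[OF ab(1), of "hd p" b] p ab True by simp
      qed
      then show ?thesis
        unfolding left correction right using True False s p Y ab(3)
        by (auto simp: path_coeff_strip_left path_coeff_not_reduced)
    qed
  qed
  then show "path_coeff w (strip_left a (X \<otimes>\<^bsub>\<Lambda>\<^esub> Y) \<oplus>\<^bsub>\<Lambda>\<^esub>
      path_coeff (src a, [a]) X \<odot>\<^bsub>\<Lambda>\<^esub> (arrow b \<otimes>\<^bsub>\<Lambda>\<^esub> strip_left b Y)) =
    path_coeff w (strip_left a X \<otimes>\<^bsub>\<Lambda>\<^esub> Y \<oplus>\<^bsub>\<Lambda>\<^esub> path_coeff (src a, []) X \<odot>\<^bsub>\<Lambda>\<^esub> strip_left a Y)"
    using X Y ab by (simp add: w)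
qed (use X Y ab in simp_all)

text \<open>
  The mirror image of \<open>strip_left_mult\<close>: the exceptional splitting is now \<open>p | b\<close>, where the last
  arrow of \<open>p\<close> is \<open>a\<close> because \<open>b\<close> has no other predecessor with which it forms a relation.
\<close>

lemma strip_right_mult:
  assumes X: "X \<in> carrier \<Lambda>" and Y: "Y \<in> carrier \<Lambda>"
    and ab: "a \<in> arcs Q" "b \<in> arcs Q" "tgt a = src b" "rel a b"
  shows "strip_right b (X \<otimes>\<^bsub>\<Lambda>\<^esub> Y) \<oplus>\<^bsub>\<Lambda>\<^esub> path_coeff (src b, [b]) Y \<odot>\<^bsub>\<Lambda>\<^esub> (strip_right a X \<otimes>\<^bsub>\<Lambda>\<^esub> arrow a) =
    X \<otimes>\<^bsub>\<Lambda>\<^esub> strip_right b Y \<oplus>\<^bsub>\<Lambda>\<^esub> path_coeff (tgt b, []) Y \<odot>\<^bsub>\<Lambda>\<^esub> strip_right b X"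
proof (rule coef_eqI)
  fix w :: "('v, 'a) path"
  obtain u p where w: "w = (u, p)" by (cases w)
  let ?s = "\<Sum>i\<le>length p. path_coeff (u, take i p) X * path_coeff (path_end u (take i p), drop i p @ [b]) Y"
  have left: "path_coeff (u, p) (strip_right b (X \<otimes>\<^bsub>\<Lambda>\<^esub> Y)) =
      (if reduced (p @ [b]) then ?s + path_coeff (u, p @ [b]) X * path_coeff (tgt b, []) Y else 0)"
    using X Y by (simp add: path_coeff_strip_right path_coeff_mult path_end_append)
  have correction: "path_coeff (u, p) (strip_right a X \<otimes>\<^bsub>\<Lambda>\<^esub> arrow a) =
      (if p \<noteq> [] \<and> last p = a then path_coeff (u, p) X else 0)"
  proof (cases p rule: rev_cases)
    case Nil
    then show ?thesis using X ab by (simp add: path_coeff_mult_arrow_right)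
  next
    case (snoc q c)
    have "path_end u q = src a" if "c = a" "path_coeff (u, q @ [a]) X \<noteq> 0"
      using path_coeff_path[OF X that(2)] by (simp add: paths_append)
    then show ?thesis using X ab snoc
      by (auto simp: path_coeff_mult_arrow_right path_coeff_strip_right path_coeff_not_reduced)
  qed
  have right: "path_coeff (u, p) (X \<otimes>\<^bsub>\<Lambda>\<^esub> strip_right b Y) = (if reduced p then ?s else 0)"
    using X Y by (simp add: path_coeff_mult path_coeff_strip_right)
  have "path_coeff (u, p) (strip_right b (X \<otimes>\<^bsub>\<Lambda>\<^esub> Y)) +
      path_coeff (src b, [b]) Y * path_coeff (u, p) (strip_right a X \<otimes>\<^bsub>\<Lambda>\<^esub> arrow a) =
      path_coeff (u, p) (X \<otimes>\<^bsub>\<Lambda>\<^esub> strip_right b Y) + path_coeff (tgt b, []) Y * path_coeff (u, p) (strip_right b X)"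
  proof (cases "reduced p")
    case False
    then show ?thesis
      using X ab by (auto simp: left correction right path_coeff_strip_right path_coeff_not_reduced
          successively_append_iff)
  next
    case True
    show ?thesis
    proof (cases "reduced (p @ [b])")
      case reduced: True
      then have "\<not> (p \<noteq> [] \<and> last p = a)" using ab(4) by (auto simp: successively_append_iff)
      then show ?thesis
        using True reduced X by (auto simp: left correction right path_coeff_strip_right)
    next
      case False
      then have p: "p \<noteq> []" "rel (last p) b" using True by (auto simp: successively_append_iff)
      have "?s = (\<Sum>i\<le>length p. if i = length p
          then path_coeff (u, p) X * path_coeff (path_end u p, [b]) Y else 0)"
      proof (intro sum.cong refl)
        fix i assume "i \<in> {..length p}"
        then have "\<not> reduced (drop i p @ [b])" if "i \<noteq> length p"
          using that p by (simp add: successively_append_iff)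
        then show "path_coeff (u, take i p) X * path_coeff (path_end u (take i p), drop i p @ [b]) Y =
            (if i = length p then path_coeff (u, p) X * path_coeff (path_end u p, [b]) Y else 0)"
          by (simp add: path_coeff_not_reduced)
      qed
      then have s: "?s = path_coeff (u, p) X * path_coeff (path_end u p, [b]) Y" by simp
      have last_p: "last p \<in> arcs Q" "path_end u p = tgt (last p)" if "path_coeff (u, p) X \<noteq> 0"
        using path_coeff_path[OF X that] p(1)
        by (cases p rule: rev_cases; simp add: paths_append path_end_append)+
      have "path_coeff (u, p) X * path_coeff (path_end u p, [b]) Y =
          (if last p = a then path_coeff (src b, [b]) Y * path_coeff (u, p) X else 0)"
      proof (cases "path_coeff (u, p) X = 0 \<or> path_coeff (path_end u p, [b]) Y = 0")
        case True
        then show ?thesis using last_p ab(3) by (cases "path_coeff (u, p) X = 0") auto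
      next
        case False
        then have "(path_end u p, [b]) \<in> paths" using path_coeff_path[OF Y] by blast
        then have "last p = a"
          using unique_predecessor[OF ab(2), of "last p" a] last_p p ab False by auto
        then show ?thesis using last_p ab(3) False by simp
      qed
      then show ?thesis
        using True False s p X
        by (auto simp: left correction right path_coeff_strip_right path_coeff_not_reduced)
    qed
  qed
  then show "path_coeff w (strip_right b (X \<otimes>\<^bsub>\<Lambda>\<^esub> Y) \<oplus>\<^bsub>\<Lambda>\<^esub>
      path_coeff (src b, [b]) Y \<odot>\<^bsub>\<Lambda>\<^esub> (strip_right a X \<otimes>\<^bsub>\<Lambda>\<^esub> arrow a)) =
    path_coeff w (X \<otimes>\<^bsub>\<Lambda>\<^esub> strip_right b Y \<oplus>\<^bsub>\<Lambda>\<^esub> path_coeff (tgt b, []) Y \<odot>\<^bsub>\<Lambda>\<^esub> strip_right b X)"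
    using X Y ab by (simp add: w)
qed (use X Y ab in simp_all)

lemma arrow_mult_zero:
  assumes "a \<in> arcs Q" "b \<in> arcs Q" "rel a b"
  shows "arrow a \<otimes>\<^bsub>\<Lambda>\<^esub> arrow b = \<zero>\<^bsub>\<Lambda>\<^esub>"
proof (rule coef_eqI)
  fix w :: "('v, 'a) path"
  obtain u p where w: "w = (u, p)" by (cases w)
  show "path_coeff w (arrow a \<otimes>\<^bsub>\<Lambda>\<^esub> arrow b) = path_coeff w \<zero>\<^bsub>\<Lambda>\<^esub>"
    using assms by (cases p) (auto simp: w path_coeff_mult_arrow_left path_coeff_arrow)
qed (use assms in simp_all)

lemma euler_mult:
  assumes X: "X \<in> carrier \<Lambda>" and Y: "Y \<in> carrier \<Lambda>"
  shows "euler (X \<otimes>\<^bsub>\<Lambda>\<^esub> Y) = X \<otimes>\<^bsub>\<Lambda>\<^esub> euler Y \<oplus>\<^bsub>\<Lambda>\<^esub> euler X \<otimes>\<^bsub>\<Lambda>\<^esub> Y"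
proof (rule coef_eqI)
  fix w :: "('v, 'a) path"
  obtain u p where w: "w = (u, p)" by (cases w)
  let ?t = "\<lambda>i. path_coeff (u, take i p) X * path_coeff (path_end u (take i p), drop i p) Y"
  have "of_nat (length p) * (\<Sum>i\<le>length p. ?t i) =
      (\<Sum>i\<le>length p. of_nat (length p - i) * ?t i + of_nat i * ?t i)"
    unfolding sum_distrib_left
    by (intro sum.cong refl) (simp add: distrib_right[symmetric] of_nat_add[symmetric] del: of_nat_add)
  also have "\<dots> = (\<Sum>i\<le>length p. path_coeff (u, take i p) X *
        (of_nat (length p - i) * path_coeff (path_end u (take i p), drop i p) Y)) +
      (\<Sum>i\<le>length p. of_nat i * path_coeff (u, take i p) X *
        path_coeff (path_end u (take i p), drop i p) Y)"
    unfolding sum.distrib[symmetric] by (intro sum.cong refl) (simp add: algebra_simps)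
  finally show "path_coeff w (euler (X \<otimes>\<^bsub>\<Lambda>\<^esub> Y)) = path_coeff w (X \<otimes>\<^bsub>\<Lambda>\<^esub> euler Y \<oplus>\<^bsub>\<Lambda>\<^esub> euler X \<otimes>\<^bsub>\<Lambda>\<^esub> Y)"
    using X Y by (simp add: w path_coeff_euler path_coeff_mult)
qed (use X Y in simp_all)

lemma vertex_subalgebra_coeff:
  assumes "e \<in> vertex_subalgebra Q I"
  shows "e \<in> carrier \<Lambda>" "p \<noteq> [] \<Longrightarrow> path_coeff (u, p) e = 0"
  using assms by (auto simp: vertex_subalgebra_def path_coeff_cls)

lemma strip_E:
  assumes "e \<in> vertex_subalgebra Q I"
  shows "strip_left a e = \<zero>\<^bsub>\<Lambda>\<^esub>" "strip_right a e = \<zero>\<^bsub>\<Lambda>\<^esub>" "euler e = \<zero>\<^bsub>\<Lambda>\<^esub>"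
proof -
  note e = vertex_subalgebra_coeff[OF assms]
  have "path_coeff (u, p) (strip_left a e) = 0" "path_coeff (u, p) (strip_right a e) = 0"
    "path_coeff (u, p) (euler e) = 0" for u p
    using e by (simp_all add: path_coeff_strip_left path_coeff_strip_right path_coeff_euler)
      (cases "p = []"; simp)
  then show "strip_left a e = \<zero>\<^bsub>\<Lambda>\<^esub>" "strip_right a e = \<zero>\<^bsub>\<Lambda>\<^esub>" "euler e = \<zero>\<^bsub>\<Lambda>\<^esub>"
    using e(1) by (simp_all add: coord_eqI)
qed

lemma strip_add:
  assumes "X \<in> carrier \<Lambda>" "Y \<in> carrier \<Lambda>"
  shows "strip_left a (X \<oplus>\<^bsub>\<Lambda>\<^esub> Y) = strip_left a X \<oplus>\<^bsub>\<Lambda>\<^esub> strip_left a Y"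
    "strip_right a (X \<oplus>\<^bsub>\<Lambda>\<^esub> Y) = strip_right a X \<oplus>\<^bsub>\<Lambda>\<^esub> strip_right a Y"
    "euler (X \<oplus>\<^bsub>\<Lambda>\<^esub> Y) = euler X \<oplus>\<^bsub>\<Lambda>\<^esub> euler Y"
proof -
  have "path_coeff (u, p) (strip_left a (X \<oplus>\<^bsub>\<Lambda>\<^esub> Y)) = path_coeff (u, p) (strip_left a X \<oplus>\<^bsub>\<Lambda>\<^esub> strip_left a Y)"
    "path_coeff (u, p) (strip_right a (X \<oplus>\<^bsub>\<Lambda>\<^esub> Y)) = path_coeff (u, p) (strip_right a X \<oplus>\<^bsub>\<Lambda>\<^esub> strip_right a Y)"
    "path_coeff (u, p) (euler (X \<oplus>\<^bsub>\<Lambda>\<^esub> Y)) = path_coeff (u, p) (euler X \<oplus>\<^bsub>\<Lambda>\<^esub> euler Y)" for u p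
    using assms by (simp_all add: path_coeff_strip_left path_coeff_strip_right path_coeff_euler distrib_left)
  then show "strip_left a (X \<oplus>\<^bsub>\<Lambda>\<^esub> Y) = strip_left a X \<oplus>\<^bsub>\<Lambda>\<^esub> strip_left a Y"
    "strip_right a (X \<oplus>\<^bsub>\<Lambda>\<^esub> Y) = strip_right a X \<oplus>\<^bsub>\<Lambda>\<^esub> strip_right a Y"
    "euler (X \<oplus>\<^bsub>\<Lambda>\<^esub> Y) = euler X \<oplus>\<^bsub>\<Lambda>\<^esub> euler Y"
    using assms by (simp_all only: coord_eqI strip_left_closed strip_right_closed euler_closed a_closed)
qed

lemma closed_walk_steps:
  assumes "pre_digraph.awalk Q u c u" "i < length c"
  shows "c ! i \<in> arcs Q" "tgt (c ! i) = src (c ! (Suc i mod length c))"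
proof -
  have c: "set c \<subseteq> arcs Q" "pre_digraph.cas Q u c u"
    using assms(1) by (auto simp: quiver.awalk_def)
  show "c ! i \<in> arcs Q" using c(1) assms(2) by auto
  have cas: "tgt (c ! i) = (if Suc i < length c then src (c ! Suc i) else v)"
    if "pre_digraph.cas Q u c v" "i < length c" for u c v i
    using that
  proof (induction c arbitrary: u i)
    case (Cons a c)
    then show ?case
      by (cases i; cases c) auto
  qed simp
  have "src (c ! 0) = u" using c(2) assms(2) by (cases c) auto
  then show "tgt (c ! i) = src (c ! (Suc i mod length c))"
  proof (cases "Suc i < length c")
    case False
    then have "Suc i = length c" using assms(2) by simp
    then show ?thesis using cas[OF c(2) assms(2)] \<open>src (c ! 0) = u\<close> by simp
  qed (use cas[OF c(2) assms(2)] in simp)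
qed

text \<open>
  The arrows of the cycle are distinct, which is why stripping the wrong one kills \<open>arrow (a 0)\<close>.
\<close>

theorem saturated_cycle_calculus:
  assumes "saturated_cycle m Q I c"
  defines "a \<equiv> \<lambda>j. c ! (j mod (m + 2))"
  shows "graded_cycle_calculus \<Lambda> path_coeff (vertex_subalgebra Q I) (m + 2) (\<lambda>j. arrow (a j))
    (\<lambda>j. strip_left (a j)) (\<lambda>j. strip_right (a j))
    (\<lambda>j. path_coeff (src (a j), [a j])) (\<lambda>j. path_coeff (src (a j), [])) (src (a 0), []) euler"
proof -
  obtain u where c: "length c = m + 2" "distinct c" "pre_digraph.awalk Q u c u"
    "\<And>i. i < m + 2 \<Longrightarrow> rel (c ! i) (c ! (Suc i mod (m + 2)))"
    using assms(1) by (auto simp: saturated_cycle_def)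
  have j: "j mod (m + 2) < m + 2" for j by simp
  have a: "a j \<in> arcs Q" "tgt (a j) = src (a (Suc j))" "rel (a j) (a (Suc j))" for j
    using closed_walk_steps[OF c(3), of "j mod (m + 2)"] c(4)[OF j[of j]] j[of j]
    unfolding a_def c(1) by (simp_all add: mod_Suc_eq)
  have ne: "a j \<noteq> a 0" if "0 < j" "j < m + 2" for j
    using that c(1,2) by (simp add: a_def nth_eq_iff_index_eq)
  have per: "a (j + (m + 2)) = a j" for j by (simp only: a_def mod_add_self2)
  have wrap: "tgt (a (m + 2 - 1)) = src (a 0)"
    using a(2)[of "m + 1"] per[of 0] by simp
  show ?thesis
  proof unfold_locales
    show "strip_right (a (Suc j)) (x \<otimes>\<^bsub>\<Lambda>\<^esub> y) \<oplus>\<^bsub>\<Lambda>\<^esub>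
        path_coeff (src (a (Suc j)), [a (Suc j)]) y \<odot>\<^bsub>\<Lambda>\<^esub> (strip_right (a j) x \<otimes>\<^bsub>\<Lambda>\<^esub> arrow (a j)) =
        x \<otimes>\<^bsub>\<Lambda>\<^esub> strip_right (a (Suc j)) y \<oplus>\<^bsub>\<Lambda>\<^esub>
        path_coeff (src (a (Suc (Suc j))), []) y \<odot>\<^bsub>\<Lambda>\<^esub> strip_right (a (Suc j)) x"
      if "x \<in> carrier \<Lambda>" "y \<in> carrier \<Lambda>" for x y j
      using strip_right_mult[OF that a(1) a(1) a(2,3), of j] a(2) by simp
    show "strip_left (a j) (x \<otimes>\<^bsub>\<Lambda>\<^esub> y) \<oplus>\<^bsub>\<Lambda>\<^esub>
        path_coeff (src (a j), [a j]) x \<odot>\<^bsub>\<Lambda>\<^esub> (arrow (a (Suc j)) \<otimes>\<^bsub>\<Lambda>\<^esub> strip_left (a (Suc j)) y) =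
        strip_left (a j) x \<otimes>\<^bsub>\<Lambda>\<^esub> y \<oplus>\<^bsub>\<Lambda>\<^esub> path_coeff (src (a j), []) x \<odot>\<^bsub>\<Lambda>\<^esub> strip_left (a j) y"
      if "x \<in> carrier \<Lambda>" "y \<in> carrier \<Lambda>" for x y j
      using strip_left_mult[OF that a(1) a(1) a(2,3)] .
    show "arrow (a j) \<otimes>\<^bsub>\<Lambda>\<^esub> arrow (a (Suc j)) = \<zero>\<^bsub>\<Lambda>\<^esub>" for j
      using arrow_mult_zero a by simp
    show "path_coeff (src (a 0), []) (strip_left (a (m + 2 - 1)) (arrow (a (m + 2 - 1)))) = 1"
      using wrap a by (simp add: path_coeff_strip_left path_coeff_arrow)
    show "strip_right (a j) (arrow (a 0)) = \<zero>\<^bsub>\<Lambda>\<^esub>" if "0 < j" "j < m + 2" for j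
    proof (rule coef_eqI)
      show "path_coeff w (strip_right (a j) (arrow (a 0))) = path_coeff w \<zero>\<^bsub>\<Lambda>\<^esub>" for w
        using ne[OF that] a by (cases w) (auto simp: path_coeff_strip_right path_coeff_arrow)
    qed (use a in simp_all)
    show "path_coeff (src (a j), [a j]) (x \<otimes>\<^bsub>\<Lambda>\<^esub> y) =
        path_coeff (src (a j), [a j]) x * path_coeff (src (a (Suc j)), []) y +
        path_coeff (src (a j), []) x * path_coeff (src (a j), [a j]) y"
      if "x \<in> carrier \<Lambda>" "y \<in> carrier \<Lambda>" for x y j
      using arrow_coeff_mult[OF that, of "a j"] a(2) by simp
    show "euler (arrow (a j)) = arrow (a j)" for j
      using a by (intro coord_eqI) (simp_all add: path_coeff_euler path_coeff_arrow)
  qed (use a per in \<open>auto simp: strip_E strip_add vertex_subalgebra_coeff vertex_coeff_mult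
      path_coeff_arrow path_coeff_strip_right path_coeff_euler euler_mult\<close>)
qed

end

section \<open>Algebras with a saturated cycle\<close>

theorem theoremB:
  fixes Q :: "('v, 'a) pre_digraph"
    and I :: "(('v, 'a) path \<Rightarrow> 'k::alg_closed_field) set"
    and \<Delta> :: "('w, 'b) pre_digraph"
    and m :: nat
  assumes "m \<ge> 1"
    and "type_A_tilde \<Delta>"
    and "acyclic (arcs_ends \<Delta>)"
    and "gentle_bound_quiver Q I"
    and "cluster_tilted_algebra m (path_algebra \<Delta>) (bound_quiver_algebra Q I)"
    and "\<exists>c. saturated_cycle m Q I c"
  shows "cup_nontrivial (bound_quiver_algebra Q I) (vertex_subalgebra Q I) \<and>
    (CHAR('k) = 0 \<longrightarrow>
       bracket_nontrivial (bound_quiver_algebra Q I) (vertex_subalgebra Q I))"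
proof -
  interpret gentle_algebra Q I by unfold_locales fact
  obtain c where c: "saturated_cycle m Q I c" using assms by blast
  show ?thesis
    using graded_cycle_calculus.cycle_cup_square_nontrivial[OF saturated_cycle_calculus[OF c]]
      graded_cycle_calculus.derivation_cycle_bracket_nontrivial[OF saturated_cycle_calculus[OF c]] by blast
qed

end
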